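(* If $G$ is a full DAG with no idle edges and connected inner graph, then $G$ admits a locally anti-blocking framing if and only if $G$ is equal to $\mathrm{Path}(\mathbf{k})$ or $\mathrm{Cycle}(\mathbf{k})$ (for some sequence $\mathbf{k}$ of positive integers).
   Context: A DAG is a finite acyclic directed graph, multiple edges allowed. An inner vertex is a vertex that is neither a source nor a sink; the inner graph is the directed subgraph induced by the inner vertices (connectedness refers to the underlying undirected graph). An inner route is a maximal directed path of the inner graph. An edge is idle if it is the only incoming edge or the only outgoing edge of an inner vertex. $G$ is full if every inner vertex has indegree $2$ and outdegree $2$. A route is a directed path from a source vertex to a sink vertex. Ample framing: for a full DAG with no idle edges, an ample framing $F$ is given by a labeling of the edges by $\{1,2\}$ such that at every inner vertex the two incoming edges have distinct labels and the two outgoing edges have distinct labels (the edges into, and the edges out of, an inner vertex being linearly ordered by label). $\mathbf{g}$-polytope: with inner vertices $1,\dots,n$, the $\mathbf{g}$-vector of a route $R$ is $\mathbf{g}(R)=(a_v)_v\in\mathbb{Z}^n$, where $a_v=-1$ if $R$ enters $v$ by an edge labeled $1$ and leaves by an edge labeled $2$; $a_v=1$ if $R$ enters $v$ by an edge labeled $2$ and leaves by an edge labeled $1$; and $a_v=0$ otherwise. The $\mathbf{g}$-polytope of $(G,F)$ is the convex hull of the $\mathbf{g}$-vectors of all routes. Locally anti-blocking: a polytope $Q\subseteq\mathbb{R}^d_{\ge 0}$ is anti-blocking if $x\in Q$ and $0\le y_i\le x_i$ for all $i$ imply $y\in Q$. A polytope $P\subset\mathbb{R}^d$ is locally anti-blocking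 if for every $\sigma\in\{-1,1\}^d$ the set $(\sigma P)\cap\mathbb{R}^d_{\ge0}$ is anti-blocking, where $\sigma x=(\sigma_1x_1,\dots,\sigma_dx_d)$. An ample framing $F$ of $G$ is a locally anti-blocking framing if the $\mathbf{g}$-polytope of $(G,F)$ is locally anti-blocking. For a sequence $\mathbf{k}=(k_1,\dots,k_r)$ of positive integers, $\mathrm{Path}(\mathbf{k})$ denotes the full DAG whose inner graph consists of $r$ inner routes of lengths $k_1,\dots,k_r$ (number of edges) concatenated so that the inner graph, viewed as an undirected graph, is an undirected path of length $k_1+\cdots+k_r$. For example, $\mathrm{Path}(n-1)$ is the caracol graph on vertices $0,\dots,n+1$ with edge multiset $\{(i,i+1): i=0,\dots,n\}\cup\{(0,i),(i,n+1): i=1,\dots,n\}$. Similarly, $\mathrm{Cycle}(\mathbf{k})$ denotes the full DAG whose inner graph consists of $r$ inner routes of lengths $k_1,\dots,k_r$ concatenated so that the inner graph, viewed as an undirected graph, is an undirected cycle of length $k_1+\cdots+k_r$ ($r$ is necessarily even). *)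

theory Defs
  imports
    "HOL-Analysis.Analysis"
    "HOL-Library.Function_Algebras"
    "HOL-Library.Sublist"
    "Graph_Theory.Graph_Theory"
begin

section \<open>Real vectors indexed by a set\<close>

text \<open>
  The index set of the ambient space (the inner vertices of a graph) is not a type, so
  vectors are functions, and for a set \<open>I\<close> the space of real vectors indexed by \<open>I\<close> is
  the subspace of functions vanishing outside \<open>I\<close>.  The pointwise scalar multiplication
  makes \<open>convex hull\<close> available.
\<close>

instantiation "fun" :: (type, real_vector) real_vector
begin

definition scaleR_fun :: "real \<Rightarrow> ('a \<Rightarrow> 'b) \<Rightarrow> 'a \<Rightarrow> 'b" where
  "scaleR_fun c f = (\<lambda>x. c *\<^sub>R f x)"

instance
  by standard (auto simp: scaleR_fun_def fun_eq_iff scaleR_add_right scaleR_add_left)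

end

definition coord_space :: "'v set \<Rightarrow> ('v \<Rightarrow> real) set" where
  "coord_space I = {x. \<forall>i. i \<notin> I \<longrightarrow> x i = 0}"

definition nonneg_orthant :: "'v set \<Rightarrow> ('v \<Rightarrow> real) set" where
  "nonneg_orthant I = {x \<in> coord_space I. \<forall>i\<in>I. 0 \<le> x i}"

definition anti_blocking :: "'v set \<Rightarrow> ('v \<Rightarrow> real) set \<Rightarrow> bool" where
  "anti_blocking I Q \<longleftrightarrow>
     Q \<subseteq> nonneg_orthant I \<and>
     (\<forall>x\<in>Q. \<forall>y\<in>coord_space I. (\<forall>i\<in>I. 0 \<le> y i \<and> y i \<le> x i) \<longrightarrow> y \<in> Q)"

definition locally_anti_blocking :: "'v set \<Rightarrow> ('v \<Rightarrow> real) set \<Rightarrow> bool" where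
  "locally_anti_blocking I P \<longleftrightarrow>
     P \<subseteq> coord_space I \<and>
     (\<forall>\<sigma>. (\<forall>i\<in>I. \<sigma> i \<in> {-1, 1}) \<longrightarrow>
        anti_blocking I ((\<lambda>x i. \<sigma> i * x i) ` P \<inter> nonneg_orthant I))"


section \<open>Full DAGs\<close>

locale dag = fin_digraph +
  assumes acyclic: "acyclic (arcs_ends G)"

definition source :: "('v, 'e) pre_digraph \<Rightarrow> 'v \<Rightarrow> bool" where
  "source G v \<longleftrightarrow> v \<in> verts G \<and> in_degree G v = 0"

definition sink :: "('v, 'e) pre_digraph \<Rightarrow> 'v \<Rightarrow> bool" where
  "sink G v \<longleftrightarrow> v \<in> verts G \<and> out_degree G v = 0"

definition inner_verts :: "('v, 'e) pre_digraph \<Rightarrow> 'v set" where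
  "inner_verts G = {v \<in> verts G. \<not> source G v \<and> \<not> sink G v}"

definition inner_graph :: "('v, 'e) pre_digraph \<Rightarrow> ('v, 'e) pre_digraph" where
  "inner_graph G = G \<restriction> inner_verts G"

definition idle :: "('v, 'e) pre_digraph \<Rightarrow> 'e \<Rightarrow> bool" where
  "idle G e \<longleftrightarrow> (\<exists>v\<in>inner_verts G. in_arcs G v = {e} \<or> out_arcs G v = {e})"

definition full :: "('v, 'e) pre_digraph \<Rightarrow> bool" where
  "full G \<longleftrightarrow> (\<forall>v\<in>inner_verts G. in_degree G v = 2 \<and> out_degree G v = 2)"

text \<open>A route is represented by its list of arcs.\<close>

definition route :: "('v, 'e) pre_digraph \<Rightarrow> 'e list \<Rightarrow> bool" where
  "route G R \<longleftrightarrow> (\<exists>s t. source G s \<and> sink G t \<and> pre_digraph.apath G s R t)"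


section \<open>Framings and g-polytopes\<close>

definition ample_framing :: "('v, 'e) pre_digraph \<Rightarrow> ('e \<Rightarrow> nat) \<Rightarrow> bool" where
  "ample_framing G F \<longleftrightarrow>
     (\<forall>e\<in>arcs G. F e \<in> {1, 2}) \<and>
     (\<forall>v\<in>inner_verts G. inj_on F (in_arcs G v) \<and> inj_on F (out_arcs G v))"

text \<open>\<open>passes G F R v i j\<close>: \<open>R\<close> enters \<open>v\<close> by an arc labeled \<open>i\<close> and leaves by an arc labeled \<open>j\<close>.\<close>

definition passes ::
    "('v, 'e) pre_digraph \<Rightarrow> ('e \<Rightarrow> nat) \<Rightarrow> 'e list \<Rightarrow> 'v \<Rightarrow> nat \<Rightarrow> nat \<Rightarrow> bool" where
  "passes G F R v i j \<longleftrightarrow>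
     (\<exists>e\<in>set R. \<exists>f\<in>set R. head G e = v \<and> F e = i \<and> tail G f = v \<and> F f = j)"

definition g_vector ::
    "('v, 'e) pre_digraph \<Rightarrow> ('e \<Rightarrow> nat) \<Rightarrow> 'e list \<Rightarrow> 'v \<Rightarrow> real" where
  "g_vector G F R = (\<lambda>v.
     if v \<in> inner_verts G \<and> passes G F R v 1 2 then -1
     else if v \<in> inner_verts G \<and> passes G F R v 2 1 then 1
     else 0)"

definition g_polytope :: "('v, 'e) pre_digraph \<Rightarrow> ('e \<Rightarrow> nat) \<Rightarrow> ('v \<Rightarrow> real) set" where
  "g_polytope G F = convex hull (g_vector G F ` {R. route G R})"

definition locally_anti_blocking_framing ::
    "('v, 'e) pre_digraph \<Rightarrow> ('e \<Rightarrow> nat) \<Rightarrow> bool" where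
  "locally_anti_blocking_framing G F \<longleftrightarrow>
     ample_framing G F \<and> locally_anti_blocking (inner_verts G) (g_polytope G F)"


section \<open>The graphs Path(k) and Cycle(k)\<close>

definition inner_path :: "('v, 'e) pre_digraph \<Rightarrow> 'e list \<Rightarrow> bool" where
  "inner_path G p \<longleftrightarrow> (\<exists>u v. pre_digraph.apath (inner_graph G) u p v)"

text \<open>
  Paths being arc lists, the empty list stands for all trivial paths at once; the
  definition is meant for paths with at least one arc (the lengths \<open>ks\<close> below are positive).
\<close>

definition inner_route :: "('v, 'e) pre_digraph \<Rightarrow> 'e list \<Rightarrow> bool" where
  "inner_route G p \<longleftrightarrow> inner_path G p \<and> (\<forall>q. inner_path G q \<and> sublist p q \<longrightarrow> q = p)"

text \<open>
  \<open>es\<close> is obtained by traversing inner routes of lengths \<open>ks\<close> one after the other, each of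
  them along or against its direction.  Maximality of inner routes forces consecutive
  routes of the undirected path or cycle \<open>es\<close> to point in opposite directions.
\<close>

definition inner_route_concat ::
    "('v, 'e) pre_digraph \<Rightarrow> nat list \<Rightarrow> 'e list \<Rightarrow> bool" where
  "inner_route_concat G ks es \<longleftrightarrow>
     (\<exists>rs ps. (\<forall>r\<in>set rs. inner_route G r) \<and> map length rs = ks \<and>
        list_all2 (\<lambda>r p. p = r \<or> p = rev r) rs ps \<and> es = concat ps)"

definition joins :: "('v, 'e) pre_digraph \<Rightarrow> 'e \<Rightarrow> 'v \<Rightarrow> 'v \<Rightarrow> bool" where
  "joins G e u v \<longleftrightarrow>
     (tail G e = u \<and> head G e = v) \<or> (tail G e = v \<and> head G e = u)"

text \<open>
  The underlying undirected multigraph of \<open>H\<close> is a path, respectively a cycle (two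
  parallel edges form a cycle of length 2), visiting the vertices \<open>vs\<close> and the edges \<open>es\<close>
  in this order.
\<close>

definition undirected_path_graph ::
    "('v, 'e) pre_digraph \<Rightarrow> 'v list \<Rightarrow> 'e list \<Rightarrow> bool" where
  "undirected_path_graph H vs es \<longleftrightarrow>
     distinct vs \<and> set vs = verts H \<and> distinct es \<and> set es = arcs H \<and>
     length vs = length es + 1 \<and>
     (\<forall>i<length es. joins H (es ! i) (vs ! i) (vs ! (i + 1)))"

definition undirected_cycle_graph ::
    "('v, 'e) pre_digraph \<Rightarrow> 'v list \<Rightarrow> 'e list \<Rightarrow> bool" where
  "undirected_cycle_graph H vs es \<longleftrightarrow>
     distinct vs \<and> set vs = verts H \<and> distinct es \<and> set es = arcs H \<and>
     es \<noteq> [] \<and> length vs = length es \<and>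
     (\<forall>i<length es. joins H (es ! i) (vs ! i) (vs ! ((i + 1) mod length es)))"

text \<open>
  \<open>Path(ks)\<close> and \<open>Cycle(ks)\<close> are determined by their inner graphs; being equal to one of
  them is a property of \<open>G\<close> that does not refer to the names of vertices and arcs, nor to
  how the arcs leaving sources and entering sinks are distributed over sources and sinks.
  \<open>ks\<close> may be empty for \<open>Path\<close>: the inner graph is then a single vertex, the undirected
  path of length 0.
\<close>

definition is_Path :: "nat list \<Rightarrow> ('v, 'e) pre_digraph \<Rightarrow> bool" where
  "is_Path ks G \<longleftrightarrow> dag G \<and> full G \<and>
     (\<exists>vs es. undirected_path_graph (inner_graph G) vs es \<and> inner_route_concat G ks es)"

definition is_Cycle :: "nat list \<Rightarrow> ('v, 'e) pre_digraph \<Rightarrow> bool" where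
  "is_Cycle ks G \<longleftrightarrow> dag G \<and> full G \<and>
     (\<exists>vs es. undirected_cycle_graph (inner_graph G) vs es \<and> inner_route_concat G ks es)"

end

(*
  Say that a framing is coherent if any two consecutive arcs between inner vertices carry the same
  label, so that every inner route has a single label.  Coherent framings are exactly the locally
  anti-blocking ones.  If consecutive arcs u -> v -> w have different labels, some route has nonzero
  coordinates at u, v and w; the outer two determine the middle one, and a linear functional
  separates the point with the middle coordinate zeroed from the polytope.  Conversely, in a
  coherent framing the set of g-vectors is closed under zeroing coordinates (continue a route along
  arcs of constant label) and under exchanging the tails of two routes at a common vertex, and these
  two properties make its convex hull locally anti-blocking.

  A coherent framing amounts to reorienting the inner arcs of label 2 so that all in- and outdegrees
  are at most one.  A connected multigraph has such an orientation iff it is a path or a cycle, and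
  the maximal stretches along which the new orientation agrees or disagrees with the old one are the
  inner routes.
*)

theory Submission
  imports Defs
begin

section \<open>Locally anti-blocking convex hulls\<close>

text \<open>The two closure properties have separate jobs. Exchange at a vertex cancels opposite
  signs, so that a point of the polytope in some orthant is already a convex combination of
  g-vectors of that orthant; zeroing then makes this smaller hull anti-blocking. An exchange must
  not create new values at other vertices. Acyclicity ensures this: no vertex other than the
  exchange vertex \<open>v\<close> can both reach \<open>v\<close> and be reached from it, so its
  coordinate is read off on one side of the cut, as a whole. Coherence binds only arcs between inner
  vertices. Since every inner vertex has exactly two arcs in and two out, a labeling of those arcs
  extends to the arcs at sources and sinks, and every inner vertex starts a walk of any prescribed
  constant label to a sink. This freedom pays for both zeroing a coordinate and building a framing
  from an orientation. In the converse, the labels of a bad pair of arcs alternate along a route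
  through three inner vertices, and the values at the outer two force the route to use exactly that
  pair.\<close>

lemma convex_combination3:
  fixes a b c :: "'a::real_vector"
  assumes S: "convex S" and nonneg: "\<alpha> \<ge> 0" "\<beta> \<ge> 0" "\<gamma> \<ge> 0" and sum: "\<alpha> + \<beta> + \<gamma> = 1"
    and mem: "\<alpha> > 0 \<Longrightarrow> a \<in> S" "\<beta> > 0 \<Longrightarrow> b \<in> S" "\<gamma> > 0 \<Longrightarrow> c \<in> S"
  shows "\<alpha> *\<^sub>R a + \<beta> *\<^sub>R b + \<gamma> *\<^sub>R c \<in> S"
proof -
  have two: "s *\<^sub>R p + t *\<^sub>R q \<in> S"
    if "s \<ge> 0" "t \<ge> 0" "s + t = 1" "s > 0 \<Longrightarrow> p \<in> S" "t > 0 \<Longrightarrow> q \<in> S" for s t and p q :: 'a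
  proof (cases "s = 0 \<or> t = 0")
    case True
    then show ?thesis using that by auto
  next
    case False
    then show ?thesis using that S by (auto intro: convexD)
  qed
  show ?thesis
  proof (cases "\<alpha> + \<beta> = 0")
    case True
    then have "\<alpha> = 0" "\<beta> = 0" "\<gamma> = 1" using nonneg sum by auto
    then show ?thesis using mem by auto
  next
    case False
    define s where "s = \<alpha> + \<beta>"
    have s: "s > 0" using False nonneg by (simp add: s_def)
    have "\<alpha>/s + \<beta>/s = 1" using s by (simp add: s_def flip: add_divide_distrib)
    moreover have "\<alpha>/s > 0 \<Longrightarrow> a \<in> S" "\<beta>/s > 0 \<Longrightarrow> b \<in> S"
      using s mem by (auto simp: zero_less_divide_iff)
    ultimately have "(\<alpha>/s) *\<^sub>R a + (\<beta>/s) *\<^sub>R b \<in> S"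
      using s nonneg by (intro two) auto
    then have "s *\<^sub>R ((\<alpha>/s) *\<^sub>R a + (\<beta>/s) *\<^sub>R b) + \<gamma> *\<^sub>R c \<in> S"
      using s nonneg mem sum by (intro two[of s \<gamma>]) (auto simp: s_def)
    then show ?thesis using s by (simp add: scaleR_add_right)
  qed
qed

text \<open>Membership is asserted only for parts of positive weight, so empty \<open>S\<close> or
  \<open>T\<close> needs no separate treatment later on. For nonempty sets, the combinations in
  \<open>?M\<close> form a convex set because weights can be regrouped within each hull.\<close>

lemma convex_hull_Un_decompose:
  fixes S T :: "'a::real_vector set"
  assumes "z \<in> convex hull (S \<union> T)"
  obtains u v s t where "u \<ge> 0" "v \<ge> 0" "u + v = 1" "u > 0 \<Longrightarrow> s \<in> convex hull S"
    "v > 0 \<Longrightarrow> t \<in> convex hull T" "z = u *\<^sub>R s + v *\<^sub>R t"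
proof -
  consider "S = {}" | "T = {}" | "S \<noteq> {}" "T \<noteq> {}" by blast
  then show ?thesis
  proof cases
    case 1
    then show ?thesis using that[of 0 1 z z] assms by auto
  next
    case 2
    then show ?thesis using that[of 1 0 z z] assms by auto
  next
    case 3
    have join: "\<exists>r\<in>R. p *\<^sub>R s + q *\<^sub>R s' = (p + q) *\<^sub>R r"
      if "convex R" "s \<in> R" "s' \<in> R" "p \<ge> 0" "q \<ge> 0" for p q s s' and R :: "'a set"
    proof (cases "p + q = 0")
      case True
      then have "p = 0" "q = 0" using that by auto
      then show ?thesis using that by auto
    next
      case False
      then have "(p/(p+q)) *\<^sub>R s + (q/(p+q)) *\<^sub>R s' \<in> R"
        using that by (intro convexD) (auto simp flip: add_divide_distrib)
      then show ?thesis using False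
        by (intro bexI[of _ "(p/(p+q)) *\<^sub>R s + (q/(p+q)) *\<^sub>R s'"]) (auto simp: scaleR_add_right)
    qed
    let ?M = "{z. \<exists>u v s t. 0 \<le> u \<and> 0 \<le> v \<and> u + v = 1 \<and>
      s \<in> convex hull S \<and> t \<in> convex hull T \<and> z = u *\<^sub>R s + v *\<^sub>R t}"
    have "convex ?M"
    proof (rule convexI)
      fix x y and p q :: real
      assume "x \<in> ?M" "y \<in> ?M" and pq: "0 \<le> p" "0 \<le> q" "p + q = 1"
      then obtain u v s t u' v' s' t' where
        1: "0 \<le> u" "0 \<le> v" "u + v = 1" "s \<in> convex hull S" "t \<in> convex hull T" "x = u *\<^sub>R s + v *\<^sub>R t" and
        2: "0 \<le> u'" "0 \<le> v'" "u' + v' = 1" "s' \<in> convex hull S" "t' \<in> convex hull T" "y = u' *\<^sub>R s' + v' *\<^sub>R t'"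
        by blast
      obtain s'' where s'': "s'' \<in> convex hull S"
        "(p * u) *\<^sub>R s + (q * u') *\<^sub>R s' = (p * u + q * u') *\<^sub>R s''"
        using join[OF convex_convex_hull 1(4) 2(4), of "p * u" "q * u'"] 1 2 pq by auto
      obtain t'' where t'': "t'' \<in> convex hull T"
        "(p * v) *\<^sub>R t + (q * v') *\<^sub>R t' = (p * v + q * v') *\<^sub>R t''"
        using join[OF convex_convex_hull 1(5) 2(5), of "p * v" "q * v'"] 1 2 pq by auto
      have "p *\<^sub>R x + q *\<^sub>R y = (p * u + q * u') *\<^sub>R s'' + (p * v + q * v') *\<^sub>R t''"
        unfolding 1 2 s''(2)[symmetric] t''(2)[symmetric] by (simp add: algebra_simps)
      moreover have "(p * u + q * u') + (p * v + q * v') = p * (u + v) + q * (u' + v')"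
        by (simp add: algebra_simps)
      ultimately show "p *\<^sub>R x + q *\<^sub>R y \<in> ?M"
        using s''(1) t''(1) 1(1-3) 2(1-3) pq
        by (intro CollectI exI[of _ "p * u + q * u'"] exI[of _ "p * v + q * v'"] exI[of _ s''] exI[of _ t'']) auto
    qed
    moreover have "x \<in> ?M" if "x \<in> S" for x
    proof -
      obtain t where "t \<in> T" using 3 by blast
      then show ?thesis
        using that by (intro CollectI exI[of _ 1] exI[of _ 0] exI[of _ x] exI[of _ t]) (auto intro: hull_inc)
    qed
    moreover have "x \<in> ?M" if "x \<in> T" for x
    proof -
      obtain t where "t \<in> S" using 3 by blast
      then show ?thesis
        using that by (intro CollectI exI[of _ 0] exI[of _ 1] exI[of _ t] exI[of _ x]) (auto intro: hull_inc)
    qed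
    ultimately have "convex hull (S \<union> T) \<subseteq> ?M"
      by (intro hull_minimal) auto
    then have "\<exists>u v s t. 0 \<le> u \<and> 0 \<le> v \<and> u + v = 1 \<and> s \<in> convex hull S \<and> t \<in> convex hull T \<and> z = u *\<^sub>R s + v *\<^sub>R t"
      using assms by blast
    then show ?thesis using that by metis
  qed
qed

text \<open>Averaging a point with positive and a point with negative coordinate lands in the
  hull of the points with coordinate zero, so negative mass can be cancelled against positive mass.\<close>

lemma convex_hull_nonneg_halfspace:
  fixes \<phi> :: "'a::real_vector \<Rightarrow> real"
  assumes lin: "linear \<phi>" and vals: "\<And>x. x \<in> X \<Longrightarrow> \<phi> x \<in> {-1, 0, 1}"
    and exch: "\<And>x y. x \<in> X \<Longrightarrow> y \<in> X \<Longrightarrow> \<phi> x = 1 \<Longrightarrow> \<phi> y = -1 \<Longrightarrow>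
      \<exists>x'\<in>X. \<exists>y'\<in>X. \<phi> x' = 0 \<and> \<phi> y' = 0 \<and> x' + y' = x + y"
    and z: "z \<in> convex hull X" "\<phi> z \<ge> 0"
  shows "z \<in> convex hull {x \<in> X. \<phi> x \<ge> 0}"
proof -
  define A where "A = {x \<in> X. \<phi> x = 1}"
  define B where "B = {x \<in> X. \<phi> x = -1}"
  define C where "C = {x \<in> X. \<phi> x = 0}"
  let ?Y = "{x \<in> X. \<phi> x \<ge> 0}"
  have hull_level: "\<phi> x = c" if "x \<in> convex hull {x \<in> X. \<phi> x = c}" for x c
  proof -
    have "convex {x. \<phi> x = c}"
      using lin by (auto simp: convex_def linear_add linear_scale simp flip: distrib_right)
    then have "convex hull {x \<in> X. \<phi> x = c} \<subseteq> {x. \<phi> x = c}" by (intro hull_minimal) auto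
    then show ?thesis using that by auto
  qed
  have AY: "convex hull A \<subseteq> convex hull ?Y" and CY: "convex hull C \<subseteq> convex hull ?Y"
    by (auto simp: A_def C_def intro!: hull_mono)
  \<comment> \<open>On \<open>A\<close> and \<open>B\<close> themselves this is the exchange
    property. It extends to the hulls one argument at a time, because for a fixed \<open>q\<close>
    the admissible points form a convex set.\<close>
  have mid: "(1/2) *\<^sub>R (a + b) \<in> convex hull C" if a: "a \<in> convex hull A" and b: "b \<in> convex hull B" for a b
  proof -
    have cvx: "convex {p. (1/2) *\<^sub>R (p + q) \<in> convex hull C}" for q
    proof (rule convexI, clarsimp)
      fix x y and u v :: real
      assume *: "(1/2) *\<^sub>R (x + q) \<in> convex hull C" "(1/2) *\<^sub>R (y + q) \<in> convex hull C"
        "0 \<le> u" "0 \<le> v" "u + v = 1"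
      have "u *\<^sub>R ((1/2) *\<^sub>R (x + q)) + v *\<^sub>R ((1/2) *\<^sub>R (y + q)) = (1/2) *\<^sub>R (u *\<^sub>R x + v *\<^sub>R y + (u + v) *\<^sub>R q)"
        by (simp add: algebra_simps)
      moreover have "u *\<^sub>R ((1/2) *\<^sub>R (x + q)) + v *\<^sub>R ((1/2) *\<^sub>R (y + q)) \<in> convex hull C"
        using * by (intro convexD[OF convex_convex_hull])
      ultimately show "(1/2) *\<^sub>R (u *\<^sub>R x + v *\<^sub>R y + q) \<in> convex hull C" using * by simp
    qed
    have AB: "(1/2) *\<^sub>R (x + y) \<in> convex hull C" if xy: "x \<in> A" "y \<in> B" for x y
    proof -
      obtain x' y' where "x' \<in> C" "y' \<in> C" "x' + y' = x + y"
        using exch[of x y] xy unfolding A_def B_def C_def by blast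
      then have "(1/2) *\<^sub>R x' + (1/2) *\<^sub>R y' \<in> convex hull C"
        by (intro convexD[OF convex_convex_hull] hull_inc) auto
      then show ?thesis using \<open>x' + y' = x + y\<close> by (metis scaleR_add_right)
    qed
    have "(1/2) *\<^sub>R (a + y) \<in> convex hull C" if "y \<in> B" for y
      using a hull_minimal[of A "{p. (1/2) *\<^sub>R (p + y) \<in> convex hull C}" convex] cvx AB that by blast
    then have "B \<subseteq> {p. (1/2) *\<^sub>R (p + a) \<in> convex hull C}" by (auto simp: add.commute)
    then have "b \<in> {p. (1/2) *\<^sub>R (p + a) \<in> convex hull C}"
      using b hull_minimal[where S=convex, OF _ cvx[of a]] by blast
    then show ?thesis by (simp add: add.commute)
  qed
  have "X = A \<union> (B \<union> C)" using vals by (auto simp: A_def B_def C_def)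
  with z obtain u v a d where 1: "u \<ge> 0" "v \<ge> 0" "u + v = 1" "u > 0 \<Longrightarrow> a \<in> convex hull A"
    "v > 0 \<Longrightarrow> d \<in> convex hull (B \<union> C)" "z = u *\<^sub>R a + v *\<^sub>R d"
    using convex_hull_Un_decompose by metis
  obtain p q b c where 2: "p \<ge> 0" "q \<ge> 0" "v > 0 \<Longrightarrow> p + q = 1" "v * p > 0 \<Longrightarrow> b \<in> convex hull B"
    "v * q > 0 \<Longrightarrow> c \<in> convex hull C" "v > 0 \<Longrightarrow> d = p *\<^sub>R b + q *\<^sub>R c"
  proof (cases "v > 0")
    case True
    then show ?thesis using convex_hull_Un_decompose[OF 1(5)] that
      by (metis less_eq_real_def mult_pos_pos zero_less_mult_pos)
  next
    case False
    \<comment> \<open>Here \<open>v = 0\<close>, so \<open>b\<close> and \<open>c\<close> get weight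
      zero and may be arbitrary.\<close>
    then show ?thesis using that[of 0 0 undefined undefined] 1 by auto
  qed
  define \<beta> where "\<beta> = v * p"
  define \<gamma> where "\<gamma> = v * q"
  have bg: "\<beta> \<ge> 0" "\<gamma> \<ge> 0" using 1 2 by (auto simp: \<beta>_def \<gamma>_def)
  have s1: "u + \<beta> + \<gamma> = 1" 
    using 1(1-3) 2(3) unfolding \<beta>_def \<gamma>_def by (cases "v = 0") (auto simp flip: distrib_left simp: add.assoc)
  have zeq: "z = u *\<^sub>R a + \<beta> *\<^sub>R b + \<gamma> *\<^sub>R c"
    using 1(2,6) 2(6) unfolding \<beta>_def \<gamma>_def by (cases "v = 0") (auto simp: scaleR_add_right)
  have "u * \<phi> a = u"
    using 1(1,4) hull_level[of a 1] unfolding A_def by (cases "u = 0") auto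
  moreover have "\<beta> * \<phi> b = - \<beta>"
    using 2(4) bg(1) hull_level[of b "-1"] unfolding B_def \<beta>_def[symmetric] by (cases "\<beta> = 0") auto
  moreover have "\<gamma> * \<phi> c = 0"
    using 2(5) bg(2) hull_level[of c 0] unfolding C_def \<gamma>_def[symmetric] by (cases "\<gamma> = 0") auto
  ultimately have "\<phi> z = u - \<beta>" using lin by (auto simp: zeq linear_add linear_scale)
  then have ub: "\<beta> \<le> u" using z by simp
  \<comment> \<open>The mass \<open>\<beta>\<close> of the negative point \<open>b\<close> is paired
    with an equal mass of \<open>a\<close>, which suffices since
    \<open>\<phi> z = u - \<beta>\<close> is nonnegative. Each pair counts as twice its
    midpoint.\<close>
  have "z = (u - \<beta>) *\<^sub>R a + (2 * \<beta>) *\<^sub>R ((1/2) *\<^sub>R (a + b)) + \<gamma> *\<^sub>R c"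
    by (simp add: zeq algebra_simps)
  also have "\<dots> \<in> convex hull ?Y"
  proof (rule convex_combination3[OF convex_convex_hull])
    show "u - \<beta> > 0 \<Longrightarrow> a \<in> convex hull ?Y" using bg 1(4) AY by auto
    show "2 * \<beta> > 0 \<Longrightarrow> (1/2) *\<^sub>R (a + b) \<in> convex hull ?Y"
      using mid[of a b] 1(4) 2(4)[folded \<beta>_def] ub CY by auto
    show "\<gamma> > 0 \<Longrightarrow> c \<in> convex hull ?Y" using 2(5) CY unfolding \<gamma>_def by auto
  qed (use bg ub s1 in auto)
  finally show ?thesis .
qed

text \<open>Stronger than \<open>x' + y' = x + y\<close>: away from \<open>v\<close> the values are
  only permuted between the two points, so sign conditions that hold for both at other coordinates
  survive the exchange.\<close>

definition exchange_closed :: "('v \<Rightarrow> real) set \<Rightarrow> bool" where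
  "exchange_closed X \<longleftrightarrow> (\<forall>x\<in>X. \<forall>y\<in>X. \<forall>v. x v = 1 \<and> y v = -1 \<longrightarrow>
     (\<exists>x'\<in>X. \<exists>y'\<in>X. x' v = 0 \<and> y' v = 0 \<and>
        (\<forall>u. u \<noteq> v \<longrightarrow> (x' u = x u \<and> y' u = y u) \<or> (x' u = y u \<and> y' u = x u))))"

lemma linear_coordinate: "linear (\<lambda>x::'v \<Rightarrow> real. x v)"
  by (rule linearI) (auto simp: scaleR_fun_def)

text \<open>Coordinates are made nonnegative one at a time. An exchange at \<open>j\<close> stays
  within the points that are nonnegative on the coordinates treated before, since it merely permutes
  values there.\<close>

lemma convex_hull_nonneg_coordinates:
  fixes X :: "('v \<Rightarrow> real) set"
  assumes "finite J" and "exchange_closed X" and vals: "\<And>x v. x \<in> X \<Longrightarrow> x v \<in> {-1, 0, 1}"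
    and "z \<in> convex hull X" and "\<And>i. i \<in> J \<Longrightarrow> z i \<ge> 0"
  shows "z \<in> convex hull {x \<in> X. \<forall>i\<in>J. x i \<ge> 0}"
  using assms(1,5)
proof (induction J rule: finite_induct)
  case empty
  then show ?case using assms(4) by simp
next
  case (insert j J)
  let ?Y = "{x \<in> X. \<forall>i\<in>J. x i \<ge> 0}"
  have "z \<in> convex hull {x \<in> ?Y. x j \<ge> 0}"
  proof (rule convex_hull_nonneg_halfspace[OF linear_coordinate])
    show "x j \<in> {-1, 0, 1}" if "x \<in> ?Y" for x using that vals by auto
    fix x y assume xy: "x \<in> ?Y" "y \<in> ?Y" "x j = 1" "y j = -1"
    then have "x \<in> X" "y \<in> X" by auto
    then obtain x' y' where *: "x' \<in> X" "y' \<in> X" "x' j = 0" "y' j = 0"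
      "\<And>u. u \<noteq> j \<Longrightarrow> (x' u = x u \<and> y' u = y u) \<or> (x' u = y u \<and> y' u = x u)"
      using assms(2) xy(3,4) unfolding exchange_closed_def by blast
    have "x' + y' = x + y"
    proof
      fix u show "(x' + y') u = (x + y) u"
        using *(3,4) *(5)[of u] xy(3,4) by (cases "u = j") auto
    qed
    moreover have "x' \<in> ?Y" "y' \<in> ?Y"
      using * xy insert.hyps by (smt (verit) mem_Collect_eq)+
    ultimately show "\<exists>x'\<in>?Y. \<exists>y'\<in>?Y. x' j = 0 \<and> y' j = 0 \<and> x' + y' = x + y"
      using * by blast
  qed (use insert in auto)
  moreover have "{x \<in> ?Y. x j \<ge> 0} = {x \<in> X. \<forall>i\<in>insert j J. x i \<ge> 0}" by auto
  ultimately show ?case by simp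
qed

text \<open>Zeroing a coordinate is linear, hence passes from \<open>Y\<close> to its hull. The
  segment from \<open>x\<close> to \<open>x(v := 0)\<close> then allows any smaller value at
  \<open>v\<close>, and finitely many such moves reach every \<open>y\<close> below
  \<open>x\<close>.\<close>

lemma anti_blocking_convex_hull:
  fixes Y :: "('v \<Rightarrow> real) set"
  assumes fin: "finite I" and Y: "Y \<subseteq> nonneg_orthant I"
    and zero: "\<And>x v. x \<in> Y \<Longrightarrow> v \<in> I \<Longrightarrow> x(v := 0) \<in> Y"
  shows "anti_blocking I (convex hull Y)"
proof -
  have cvx: "convex (nonneg_orthant I)"
    by (auto simp: convex_def nonneg_orthant_def coord_space_def scaleR_fun_def)
  have zhull: "x(v := 0) \<in> convex hull Y" if "x \<in> convex hull Y" "v \<in> I" for x v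
  proof -
    have "linear (\<lambda>x::'v \<Rightarrow> real. x(v := 0))"
      by (rule linearI) (auto simp: scaleR_fun_def fun_eq_iff)
    then have "x(v := 0) \<in> convex hull ((\<lambda>x. x(v := 0)) ` Y)"
      using that(1) by (rule in_convex_hull_linear_image)
    moreover have "(\<lambda>x. x(v := 0)) ` Y \<subseteq> Y" using zero that by auto
    ultimately show ?thesis using hull_mono by blast
  qed
  have shrink: "x(v := c) \<in> convex hull Y" if "x \<in> convex hull Y" "v \<in> I" "0 \<le> c" "c \<le> x v" for x v c
  proof (cases "x v = 0")
    case True
    then have "x(v := c) = x" using that by (auto simp: fun_eq_iff)
    then show ?thesis using that by simp
  next
    case False
    have "(c / x v) *\<^sub>R x + (1 - c / x v) *\<^sub>R x(v := 0) \<in> convex hull Y"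
      using that False zhull by (intro convexD[OF convex_convex_hull]) auto
    also have "(c / x v) *\<^sub>R x + (1 - c / x v) *\<^sub>R x(v := 0) = x(v := c)"
      using False by (auto simp: fun_eq_iff scaleR_fun_def field_simps)
    finally show ?thesis .
  qed
  have main: "(\<lambda>i. if i \<in> J then y i else x i) \<in> convex hull Y"
    if "finite J" "J \<subseteq> I" "x \<in> convex hull Y" "\<forall>i\<in>I. 0 \<le> y i \<and> y i \<le> x i" for J x y
    using that
  proof (induction J rule: finite_induct)
    case empty
    then show ?case by simp
  next
    case (insert j J)
    let ?w = "\<lambda>i. if i \<in> J then y i else x i"
    have "?w(j := y j) \<in> convex hull Y"
      using insert by (intro shrink) auto
    also have "?w(j := y j) = (\<lambda>i. if i \<in> insert j J then y i else x i)" by auto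
    finally show ?case .
  qed
  have sub: "convex hull Y \<subseteq> nonneg_orthant I" using Y cvx by (rule hull_minimal)
  show ?thesis unfolding anti_blocking_def
  proof (intro conjI ballI impI sub)
    fix x y assume x: "x \<in> convex hull Y" and y: "y \<in> coord_space I" and le: "\<forall>i\<in>I. 0 \<le> y i \<and> y i \<le> x i"
    have "(\<lambda>i. if i \<in> I then y i else x i) = y"
      using x y sub by (auto simp: fun_eq_iff coord_space_def nonneg_orthant_def subset_iff)
    then show "y \<in> convex hull Y" using main[OF fin order_refl x le] by simp
  qed
qed

text \<open>A sign change is linear and preserves both closure properties, so every orthant reduces
  to the nonnegative one. There exchange identifies the section of the hull with the hull of the
  points in the orthant.\<close>

lemma locally_anti_blocking_convex_hull:
  fixes X :: "('v \<Rightarrow> real) set"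
  assumes fin: "finite I" and X: "X \<subseteq> coord_space I"
    and vals: "\<And>x v. x \<in> X \<Longrightarrow> x v \<in> {-1, 0, 1}" and exch: "exchange_closed X"
    and zero: "\<And>x v. x \<in> X \<Longrightarrow> v \<in> I \<Longrightarrow> x(v := 0) \<in> X"
  shows "locally_anti_blocking I (convex hull X)"
  unfolding locally_anti_blocking_def
proof (intro conjI allI impI)
  have "convex (coord_space I)"
    by (auto simp: convex_def coord_space_def scaleR_fun_def)
  with X show sub: "convex hull X \<subseteq> coord_space I" by (rule hull_minimal)
  fix \<sigma> :: "'v \<Rightarrow> real" assume \<sigma>: "\<forall>i\<in>I. \<sigma> i \<in> {-1, 1}"
  let ?s = "\<lambda>x i. \<sigma> i * x i"
  define X' where "X' = ?s ` X"
  have lin: "linear ?s" by (rule linearI) (auto simp: scaleR_fun_def fun_eq_iff algebra_simps)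
  have hull: "?s ` (convex hull X) = convex hull X'"
    unfolding X'_def by (rule convex_hull_linear_image[OF lin])
  have off: "x i = 0" if "x \<in> X" "i \<notin> I" for x i using X that by (auto simp: coord_space_def)
  have vals': "x v \<in> {-1, 0, 1}" if x: "x \<in> X'" for x v
  proof -
    obtain x0 where x0: "x0 \<in> X" "x = ?s x0" using x by (auto simp: X'_def)
    then show ?thesis using vals[of x0 v] \<sigma> off[of x0 v] by (cases "v \<in> I") auto
  qed
  have exch': "exchange_closed X'"
    unfolding exchange_closed_def
  proof (intro ballI allI impI)
    fix x y v assume xy: "x \<in> X'" "y \<in> X'" "x v = 1 \<and> y v = -1"
    obtain x0 y0 where 0: "x0 \<in> X" "x = ?s x0" "y0 \<in> X" "y = ?s y0" using xy by (auto simp: X'_def)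
    have vI: "v \<in> I" using 0 xy off by force
    have "\<exists>x'\<in>X. \<exists>y'\<in>X. x' v = 0 \<and> y' v = 0 \<and>
        (\<forall>u. u \<noteq> v \<longrightarrow> (x' u = x0 u \<and> y' u = y0 u) \<or> (x' u = y0 u \<and> y' u = x0 u))"
    proof (cases "\<sigma> v = 1")
      case True
      then show ?thesis using exch xy(3) 0 unfolding exchange_closed_def by auto
    next
      case False
      \<comment> \<open>The flip at \<open>v\<close> makes the two points trade the roles of
        positive and negative.\<close>
      then have "\<sigma> v = -1" using \<sigma> vI by auto
      then have "y0 v = 1 \<and> x0 v = -1" using 0 xy by auto
      then obtain x' y' where "x' \<in> X" "y' \<in> X" "x' v = 0 \<and> y' v = 0 \<and>
        (\<forall>u. u \<noteq> v \<longrightarrow> (x' u = y0 u \<and> y' u = x0 u) \<or> (x' u = x0 u \<and> y' u = y0 u))"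
        using exch[unfolded exchange_closed_def, rule_format, OF 0(3,1)] by blast
      then show ?thesis by blast
    qed
    then obtain x' y' where *: "x' \<in> X" "y' \<in> X" "x' v = 0 \<and> y' v = 0 \<and>
        (\<forall>u. u \<noteq> v \<longrightarrow> (x' u = x0 u \<and> y' u = y0 u) \<or> (x' u = y0 u \<and> y' u = x0 u))" by (elim bexE)
    show "\<exists>x'\<in>X'. \<exists>y'\<in>X'. x' v = 0 \<and> y' v = 0 \<and>
        (\<forall>u. u \<noteq> v \<longrightarrow> (x' u = x u \<and> y' u = y u) \<or> (x' u = y u \<and> y' u = x u))"
    proof (rule bexI[of _ "?s x'"], rule bexI[of _ "?s y'"], intro conjI allI impI)
      show "?s x' \<in> X'" "?s y' \<in> X'" using * by (auto simp: X'_def)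
      show "?s x' v = 0" "?s y' v = 0" using * by auto
      fix u assume "u \<noteq> v"
      then have "(x' u = x0 u \<and> y' u = y0 u) \<or> (x' u = y0 u \<and> y' u = x0 u)" using * by blast
      then show "(?s x' u = x u \<and> ?s y' u = y u) \<or> (?s x' u = y u \<and> ?s y' u = x u)"
        unfolding 0(2,4) by (elim disjE) simp_all
    qed
  qed
  define Y where "Y = {x \<in> X'. \<forall>i\<in>I. x i \<ge> 0}"
  have X'sub: "X' \<subseteq> coord_space I" using X by (auto simp: X'_def coord_space_def)
  have Ysub: "Y \<subseteq> nonneg_orthant I" using X'sub by (auto simp: Y_def nonneg_orthant_def)
  have "convex (nonneg_orthant I)"
    by (auto simp: convex_def nonneg_orthant_def coord_space_def scaleR_fun_def)
  with Ysub have "convex hull Y \<subseteq> nonneg_orthant I" by (rule hull_minimal)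
  moreover have "convex hull Y \<subseteq> convex hull X'" by (rule hull_mono) (auto simp: Y_def)
  moreover have "z \<in> convex hull Y" if "z \<in> convex hull X'" "z \<in> nonneg_orthant I" for z
    unfolding Y_def using that vals'
    by (intro convex_hull_nonneg_coordinates[OF fin exch']) (auto simp: nonneg_orthant_def)
  ultimately have "convex hull X' \<inter> nonneg_orthant I = convex hull Y" by blast
  moreover have "anti_blocking I (convex hull Y)"
  proof (rule anti_blocking_convex_hull[OF fin Ysub])
    fix x v assume x: "x \<in> Y" "v \<in> I"
    then obtain x0 where x0: "x0 \<in> X" "x = ?s x0" by (auto simp: Y_def X'_def)
    have "x(v := 0) = ?s (x0(v := 0))" using x0 by auto
    then have "x(v := 0) \<in> X'" using zero[OF x0(1) x(2)] unfolding X'_def by (rule image_eqI)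
    then show "x(v := 0) \<in> Y" using x by (auto simp: Y_def)
  qed
  ultimately show "anti_blocking I (?s ` (convex hull X) \<inter> nonneg_orthant I)"
    using hull by simp
qed

section \<open>Coherent framings\<close>

context dag
begin

abbreviation inners :: "'a set" where
  "inners \<equiv> Defs.inner_verts G"

lemma not_reachable1_self: "\<not> v \<rightarrow>\<^sup>+ v"
  using acyclic by (auto simp: acyclic_def)

lemma reachable_antisym: "u \<rightarrow>\<^sup>* v \<Longrightarrow> v \<rightarrow>\<^sup>* u \<Longrightarrow> u = v"
  using not_reachable1_self by (metis reachable_neq_reachable1 reachable_reachable1_trans)

lemma arc_not_reachable_back: "e \<in> arcs G \<Longrightarrow> \<not> head G e \<rightarrow>\<^sup>* tail G e"
  using not_reachable1_self in_arcs_imp_in_arcs_ends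
  by (metis reachable_reachable1_trans trancl.r_into_trancl)

lemma awalk_arc_reachable:
  assumes "awalk u p v" "e \<in> set p"
  shows "u \<rightarrow>\<^sup>* tail G e" "head G e \<rightarrow>\<^sup>* v"
proof -
  obtain a b where "p = a @ e # b" using assms(2) by (meson split_list)
  then show "u \<rightarrow>\<^sup>* tail G e" "head G e \<rightarrow>\<^sup>* v"
    using assms(1) by (auto simp: awalk_Cons_iff intro: awalkI_apath reachable_awalkI)
qed

text \<open>A return to an earlier vertex would close a directed cycle. Routes can therefore be cut
  and glued as walks, with no check that vertices stay distinct.\<close>

lemma awalk_imp_apath: "awalk u p v \<Longrightarrow> apath u p v"
proof (induction p arbitrary: u)
  case Nil
  then show ?case by (auto simp: awalk_Nil_iff apath_Nil_iff)
next
  case (Cons e p)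
  then have e: "e \<in> arcs G" "tail G e = u" and p: "awalk (head G e) p v"
    by (auto simp: awalk_Cons_iff)
  have "u \<notin> set (awalk_verts (head G e) p)"
  proof
    assume "u \<in> set (awalk_verts (head G e) p)"
    then have "head G e \<rightarrow>\<^sup>* u" using p by (rule awalk_verts_reachable_from[rotated])
    then show False using arc_not_reachable_back e by blast
  qed
  then show ?case using Cons.IH[OF p] e by (simp add: apath_Cons_iff)
qed

lemma route_iff_awalk: "route G R \<longleftrightarrow> (\<exists>s t. source G s \<and> sink G t \<and> awalk s R t)"
  unfolding route_def using awalk_imp_apath awalkI_apath by blast

lemma awalk_inj_on_head: "awalk u p v \<Longrightarrow> inj_on (head G) (set p)"
  using awalk_imp_apath[of u p v] awalk_verts_conv'[of u p v] unfolding apath_def awalk_def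
  by (cases "p = []") (auto simp: distinct_map)

lemma awalk_inj_on_tail: "awalk u p v \<Longrightarrow> inj_on (tail G) (set p)"
  using awalk_imp_apath[of u p v] unfolding apath_def
  by (cases "p = []") (auto simp: awalk_verts_conv distinct_map)

lemma awalk_distinct: "awalk u p v \<Longrightarrow> distinct p"
  using awalk_imp_apath[of u p v] unfolding apath_def
  by (cases "p = []") (auto simp: awalk_verts_conv distinct_map)

lemma not_source_head: "e \<in> arcs G \<Longrightarrow> \<not> source G (head G e)"
  unfolding source_def in_degree_def using finite_in_arcs[of "head G e"] by (auto simp: card_eq_0_iff)

lemma not_sink_tail: "e \<in> arcs G \<Longrightarrow> \<not> sink G (tail G e)"
  unfolding sink_def out_degree_def using finite_out_arcs[of "tail G e"] by (auto simp: card_eq_0_iff)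

lemma not_sinkE:
  assumes "v \<in> verts G" "\<not> sink G v"
  obtains e where "e \<in> arcs G" "tail G e = v"
proof -
  have "out_arcs G v \<noteq> {}" using assms unfolding sink_def out_degree_def by auto
  then show ?thesis using that by (metis all_not_in_conv in_out_arcs_conv)
qed

lemma not_sourceE:
  assumes "v \<in> verts G" "\<not> source G v"
  obtains e where "e \<in> arcs G" "head G e = v"
proof -
  have "in_arcs G v \<noteq> {}" using assms unfolding source_def in_degree_def by auto
  then show ?thesis using that by (metis all_not_in_conv in_in_arcs_conv)
qed

lemma inner_vertsD:
  assumes "v \<in> inners" shows "v \<in> verts G" "\<not> source G v" "\<not> sink G v"
  using assms by (auto simp: Defs.inner_verts_def)

lemma finite_inner_verts: "finite (inners)"
  by (auto simp: Defs.inner_verts_def)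

lemma finite_arcs_ends: "finite (arcs_ends G)"
  by (simp add: arcs_ends_def)

text \<open>Well-founded induction along the arcs. The set \<open>E\<close> serves two uses: with
  \<open>UNIV\<close> it gives routes through a vertex, with a label condition it gives walks of
  constant label.\<close>

lemma awalk_to_sink:
  assumes "\<And>w. w \<in> verts G \<Longrightarrow> \<not> sink G w \<Longrightarrow> \<exists>e\<in>E. e \<in> arcs G \<and> tail G e = w"
    and "v \<in> verts G"
  shows "\<exists>q t. sink G t \<and> awalk v q t \<and> set q \<subseteq> E"
proof -
  have "wf ((arcs_ends G)\<inverse>)"
    using finite_arcs_ends acyclic by (rule finite_acyclic_wf_converse)
  then show ?thesis using assms(2)
  proof (induction v rule: wf_induct_rule)
    case (less v)
    show ?case
    proof (cases "sink G v")
      case True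
      then show ?thesis using less.prems by (intro exI[of _ "[]"]) (auto simp: awalk_Nil_iff)
    next
      case False
      with assms(1) less.prems obtain e where e: "e \<in> E" "e \<in> arcs G" "tail G e = v" by blast
      then obtain q t where "sink G t" "awalk (head G e) q t" "set q \<subseteq> E"
        using less.IH[of "head G e"] in_arcs_imp_in_arcs_ends by fastforce
      then show ?thesis using e by (intro exI[of _ "e # q"]) (auto simp: awalk_Cons_iff)
    qed
  qed
qed

lemma awalk_from_source:
  assumes "\<And>w. w \<in> verts G \<Longrightarrow> \<not> source G w \<Longrightarrow> \<exists>e\<in>E. e \<in> arcs G \<and> head G e = w"
    and "v \<in> verts G"
  shows "\<exists>p s. source G s \<and> awalk s p v \<and> set p \<subseteq> E"
proof -
  have "wf (arcs_ends G)"
    using finite_arcs_ends acyclic by (rule finite_acyclic_wf)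
  then show ?thesis using assms(2)
  proof (induction v rule: wf_induct_rule)
    case (less v)
    show ?case
    proof (cases "source G v")
      case True
      then show ?thesis using less.prems by (intro exI[of _ "[]"]) (auto simp: awalk_Nil_iff)
    next
      case False
      with assms(1) less.prems obtain e where e: "e \<in> E" "e \<in> arcs G" "head G e = v" by blast
      then obtain p s where "source G s" "awalk s p (tail G e)" "set p \<subseteq> E"
        using less.IH[of "tail G e"] in_arcs_imp_in_arcs_ends by fastforce
      moreover have "awalk (tail G e) [e] v" using e by (auto intro: arc_implies_awalk)
      ultimately show ?thesis using e 
        by (intro exI[of _ "p @ [e]"] exI[of _ s]) (auto intro: awalk_appendI)
    qed
  qed
qed

lemma vert_has_route:
  assumes "v \<in> verts G"
  obtains s p q t where "source G s" "sink G t" "awalk s p v" "awalk v q t"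
proof -
  obtain p s where "source G s" "awalk s p v"
    using awalk_from_source[of UNIV v] assms by (auto elim: not_sourceE)
  moreover obtain q t where "sink G t" "awalk v q t"
    using awalk_to_sink[of UNIV v] assms by (auto elim: not_sinkE)
  ultimately show ?thesis using that by blast
qed

lemma awalk_through_head:
  assumes "awalk u p v" "e \<in> set p" "head G e \<noteq> v"
  shows "\<exists>f\<in>set p. tail G f = head G e"
proof -
  obtain a b where p: "p = a @ e # b" using assms(2) by (meson split_list)
  then have "awalk (head G e) b v" using assms(1) by (auto simp: awalk_Cons_iff)
  then show ?thesis using assms(3) p by (cases b) (auto simp: awalk_simps)
qed

lemma awalk_through_tail:
  assumes "awalk u p v" "f \<in> set p" "tail G f \<noteq> u"
  shows "\<exists>e\<in>set p. head G e = tail G f"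
proof -
  obtain a b where p: "p = a @ f # b" using assms(2) by (meson split_list)
  then have a: "awalk u a (tail G f)" using assms(1) by (auto simp: awalk_Cons_iff)
  show ?thesis
  proof (cases a rule: rev_cases)
    case Nil
    then show ?thesis using a assms(3) by (auto simp: awalk_simps)
  next
    case (snoc a' e)
    then have "head G e = tail G f" using a by (auto simp: awalk_simps)
    then show ?thesis using p snoc by auto
  qed
qed

lemma route_through_iff:
  assumes "route G R" "v \<in> inners"
  shows "(\<exists>e\<in>set R. head G e = v) \<longleftrightarrow> (\<exists>f\<in>set R. tail G f = v)"
proof -
  obtain s t where "source G s" "sink G t" "awalk s R t" using assms by (auto simp: route_iff_awalk)
  then show ?thesis
    using awalk_through_head[of s R t] awalk_through_tail[of s R t] inner_vertsD[OF assms(2)] by metis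
qed

text \<open>The arc after \<open>e\<close> leaves \<open>v\<close>, and so does \<open>f\<close>.
  Tails are injective along a walk of a DAG, so the two coincide.\<close>

lemma route_splitE:
  assumes "route G R" "e \<in> set R" "f \<in> set R" "head G e = v" "tail G f = v"
  obtains s p q t where "R = (p @ [e]) @ f # q" "source G s" "sink G t" "awalk s (p @ [e]) v" "awalk v (f # q) t"
proof -
  obtain s t where st: "source G s" "sink G t" "awalk s R t" using assms by (auto simp: route_iff_awalk)
  obtain p r where R: "R = p @ e # r" using assms(2) by (meson split_list)
  then have r: "awalk v r t" and p: "awalk s (p @ [e]) v"
    using st assms by (auto simp: awalk_simps)
  have "v \<in> verts G" using r by auto
  moreover have "f \<in> arcs G" using assms st by auto
  ultimately have "v \<noteq> t" using not_sink_tail assms(5) st(2) by blast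
  then obtain f' q where r': "r = f' # q" using r by (cases r) (auto simp: awalk_simps)
  then have "tail G f' = tail G f" using r assms by (auto simp: awalk_simps)
  moreover have "f' \<in> set R" using R r' by simp
  ultimately have "f' = f" using awalk_inj_on_tail[OF st(3)] assms(3) inj_onD by metis
  then show ?thesis using that[of p q s t] R r' r p st by simp
qed

end

text \<open>Summed along a walk, these weights telescope to the difference of the labels by which the
  walk enters and leaves a vertex, which is the coordinate of its g-vector.\<close>

definition label_change :: "('v, 'e) pre_digraph \<Rightarrow> ('e \<Rightarrow> nat) \<Rightarrow> 'e list \<Rightarrow> 'v \<Rightarrow> real" where
  "label_change G F p v =
     (\<Sum>e\<leftarrow>p. (if head G e = v then real (F e) else 0) - (if tail G e = v then real (F e) else 0))"

lemma label_change_append: "label_change G F (p @ q) v = label_change G F p v + label_change G F q v"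
  by (simp add: label_change_def)

lemma label_change_eq_0:
  "(\<And>e. e \<in> set p \<Longrightarrow> head G e \<noteq> v \<and> tail G e \<noteq> v) \<Longrightarrow> label_change G F p v = 0"
  by (induction p) (auto simp: label_change_def)

section \<open>Labels and g-vectors along routes\<close>

locale ample_framed_dag = dag +
  fixes F :: "'b \<Rightarrow> nat"
  assumes full: "full G" and ample: "ample_framing G F"
begin

lemma label: "e \<in> arcs G \<Longrightarrow> F e = 1 \<or> F e = 2"
  using ample by (auto simp: ample_framing_def)

lemma inj_in: "v \<in> inners \<Longrightarrow> inj_on F (in_arcs G v)"
  and inj_out: "v \<in> inners \<Longrightarrow> inj_on F (out_arcs G v)"
  using ample by (auto simp: ample_framing_def)

lemma label_image:
  assumes "inj_on F A" "card A = 2" "A \<subseteq> arcs G"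
  shows "F ` A = {1, 2}"
  using assms label by (intro card_subset_eq) (auto simp: card_image)

text \<open>Fullness provides two arcs and ampleness makes their labels differ, so both labels
  occur.\<close>

lemma in_arc_labeled:
  assumes "v \<in> inners" "c \<in> {1, 2}"
  obtains e where "e \<in> arcs G" "head G e = v" "F e = c"
proof -
  have "F ` in_arcs G v = {1, 2}"
    using assms(1) full inj_in by (intro label_image) (auto simp: full_def in_degree_def)
  then show ?thesis using assms(2) that by (metis (no_types, lifting) imageE in_in_arcs_conv)
qed

lemma out_arc_labeled:
  assumes "v \<in> inners" "c \<in> {1, 2}"
  obtains e where "e \<in> arcs G" "tail G e = v" "F e = c"
proof -
  have "F ` out_arcs G v = {1, 2}"
    using assms(1) full inj_out by (intro label_image) (auto simp: full_def out_degree_def)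
  then show ?thesis using assms(2) that by (metis (no_types, lifting) imageE in_out_arcs_conv)
qed

lemma in_arcs_eqI:
  "\<lbrakk>e \<in> arcs G; e' \<in> arcs G; head G e = v; head G e' = v; v \<in> inners; F e = F e'\<rbrakk> \<Longrightarrow> e = e'"
  using inj_in[of v] by (auto dest: inj_onD)

lemma out_arcs_eqI:
  "\<lbrakk>e \<in> arcs G; e' \<in> arcs G; tail G e = v; tail G e' = v; v \<in> inners; F e = F e'\<rbrakk> \<Longrightarrow> e = e'"
  using inj_out[of v] by (auto dest: inj_onD)

lemma route_subset_arcs: "route G R \<Longrightarrow> set R \<subseteq> arcs G"
  by (auto simp: route_iff_awalk)

text \<open>A route meets \<open>v\<close> only once, so \<open>e\<close> and \<open>f\<close> are
  its only arcs there. With labels 1 and 2 their difference takes exactly the prescribed values: 1 -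
  2 = -1, 2 - 1 = 1, and 0 for equal labels.\<close>

lemma g_vector_eq:
  assumes R: "route G R" and ef: "e \<in> set R" "f \<in> set R" "head G e = v" "tail G f = v"
    and v: "v \<in> inners"
  shows "g_vector G F R v = real (F e) - real (F f)"
proof -
  obtain s t where st: "awalk s R t" using R by (auto simp: route_iff_awalk)
  have "head G d = v \<longleftrightarrow> d = e" "tail G d = v \<longleftrightarrow> d = f" if "d \<in> set R" for d
    using ef that inj_onD[OF awalk_inj_on_head[OF st], of d e] inj_onD[OF awalk_inj_on_tail[OF st], of d f]
    by auto
  then have "passes G F R v i j \<longleftrightarrow> F e = i \<and> F f = j" for i j
    using ef unfolding passes_def by metis
  moreover have "F e = 1 \<or> F e = 2" "F f = 1 \<or> F f = 2"
    using label route_subset_arcs[OF R] ef by auto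
  ultimately show ?thesis using v by (auto simp: g_vector_def)
qed

lemma g_vector_neq_0E:
  assumes "g_vector G F R v \<noteq> 0"
  obtains e f where "v \<in> inners" "e \<in> set R" "f \<in> set R" "head G e = v" "tail G f = v"
  using assms that unfolding g_vector_def passes_def by (auto split: if_splits)

lemma g_vector_vals: "g_vector G F R v \<in> {-1, 0, 1}"
  by (simp add: g_vector_def)

text \<open>The point is additivity: unlike \<open>g_vector\<close>, \<open>label_change\<close>
  splits over concatenation, so replacing a segment of a route changes a coordinate only through
  that segment.\<close>

lemma g_vector_label_change:
  assumes R: "route G R" and v: "v \<in> inners"
  shows "g_vector G F R v = label_change G F R v"
proof (cases "\<exists>e\<in>set R. head G e = v")
  case True
  then obtain e f where ef: "e \<in> set R" "f \<in> set R" "head G e = v" "tail G f = v"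
    using route_through_iff[OF R v] by blast
  obtain s t where st: "awalk s R t" using R by (auto simp: route_iff_awalk)
  have ht: "head G d = v \<longleftrightarrow> d = e" "tail G d = v \<longleftrightarrow> d = f" if "d \<in> set R" for d
    using ef that inj_onD[OF awalk_inj_on_head[OF st], of d e] inj_onD[OF awalk_inj_on_tail[OF st], of d f]
    by auto
  have "label_change G F R v =
      (\<Sum>d\<in>set R. (if head G d = v then real (F d) else 0) - (if tail G d = v then real (F d) else 0))"
    unfolding label_change_def using awalk_distinct[OF st] by (rule sum_list_distinct_conv_sum_set)
  also have "\<dots> = (\<Sum>d\<in>set R. (if d = e then real (F d) else 0) - (if d = f then real (F d) else 0))"
    by (intro sum.cong) (auto simp: ht)
  also have "\<dots> = real (F e) - real (F f)"
    using ef by (simp add: sum_subtractf)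
  finally show ?thesis using g_vector_eq[OF R ef v] by simp
next
  case False
  then have "label_change G F R v = 0"
    using route_through_iff[OF R v] by (intro label_change_eq_0) auto
  moreover have "g_vector G F R v = 0" using False g_vector_neq_0E by metis
  ultimately show ?thesis by simp
qed

end

context ample_framed_dag
begin

text \<open>Every inner route carries a single label.\<close>

definition coherent :: bool where
  "coherent \<longleftrightarrow> (\<forall>e\<in>arcs G. \<forall>f\<in>arcs G. tail G e \<in> inners \<and> head G e \<in> inners \<and>
     tail G f \<in> inners \<and> head G f \<in> inners \<and> head G e = tail G f \<longrightarrow> F e = F f)"

text \<open>Inside the walk the label added on entering a vertex is subtracted on leaving it, so
  only the two ends contribute. A detour of constant label is thus invisible to all inner vertices
  except its ends.\<close>

lemma label_change_const:
  assumes "awalk u p w" "\<And>e. e \<in> set p \<Longrightarrow> F e = c"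
  shows "label_change G F p v = (if v = w then c else 0) - (if v = u then real c else 0)"
  using assms
proof (induction p arbitrary: u)
  case Nil
  then show ?case by (auto simp: awalk_Nil_iff label_change_def)
next
  case (Cons e p)
  then have "label_change G F p v = (if v = w then c else 0) - (if v = head G e then real c else 0)"
    by (auto simp: awalk_Cons_iff)
  then show ?case using Cons.prems by (auto simp: awalk_Cons_iff label_change_def)
qed

text \<open>At \<open>v\<close> one route enters with label 2 and leaves with 1, the other enters
  with 1 and leaves with 2; after their tails are swapped both pass with equal labels. Another
  vertex \<open>u\<close> cannot both reach \<open>v\<close> and be reached from it. If it does not
  reach \<open>v\<close>, both initial segments contribute nothing and the values at
  \<open>u\<close> swap; if it is not reached, both final segments contribute nothing and the values
  stay.\<close>

lemma exchange_closed_g_vectors: "exchange_closed (g_vector G F ` {R. route G R})"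
  unfolding exchange_closed_def
proof (intro ballI allI impI)
  fix x y v
  assume x: "x \<in> g_vector G F ` {R. route G R}" and y: "y \<in> g_vector G F ` {R. route G R}"
    and xy: "x v = 1 \<and> y v = -1"
  obtain R where R: "route G R" "x = g_vector G F R" using x by auto
  obtain S where S: "route G S" "y = g_vector G F S" using y by auto
  obtain e f where ef: "v \<in> inners" "e \<in> set R" "f \<in> set R" "head G e = v" "tail G f = v"
    using g_vector_neq_0E[of R v] R xy by auto
  obtain e' f' where ef': "e' \<in> set S" "f' \<in> set S" "head G e' = v" "tail G f' = v"
    using g_vector_neq_0E[of S v] S xy by (metis neg_equal_0_iff_equal zero_neq_one)
  obtain s p q t where pq: "R = (p @ [e]) @ f # q" "source G s" "sink G t"
    "awalk s (p @ [e]) v" "awalk v (f # q) t"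
    by (rule route_splitE[OF R(1) ef(2-5)])
  obtain s' p' q' t' where pq': "S = (p' @ [e']) @ f' # q'" "source G s'" "sink G t'"
    "awalk s' (p' @ [e']) v" "awalk v (f' # q') t'"
    by (rule route_splitE[OF S(1) ef'])
  define R' where "R' = (p @ [e]) @ f' # q'"
  define S' where "S' = (p' @ [e']) @ f # q"
  have R': "route G R'"
    unfolding R'_def route_iff_awalk using pq pq' awalk_appendI by blast
  have S': "route G S'"
    unfolding S'_def route_iff_awalk using pq pq' awalk_appendI by blast
  have "e \<in> arcs G" "f \<in> arcs G" "e' \<in> arcs G" "f' \<in> arcs G"
    using ef ef' R S route_subset_arcs by auto
  note labels = this[THEN label]
  have g: "real (F e) - real (F f) = 1" "real (F e') - real (F f') = -1"
    using g_vector_eq[OF R(1) ef(2-5,1)] g_vector_eq[OF S(1) ef' ef(1)] R S xy by auto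
  have "F e = F f'" "F e' = F f" using labels g by auto
  moreover have "g_vector G F R' v = real (F e) - real (F f')"
    using ef ef' by (intro g_vector_eq[OF R']) (auto simp: R'_def)
  moreover have "g_vector G F S' v = real (F e') - real (F f)"
    using ef ef' by (intro g_vector_eq[OF S']) (auto simp: S'_def)
  ultimately have 0: "g_vector G F R' v = 0" "g_vector G F S' v = 0" by auto
  have "(g_vector G F R' u = x u \<and> g_vector G F S' u = y u) \<or>
        (g_vector G F R' u = y u \<and> g_vector G F S' u = x u)" if uv: "u \<noteq> v" for u
  proof (cases "u \<in> inners")
    case False
    then show ?thesis by (simp add: R S g_vector_def)
  next
    case True
    have before: "u \<rightarrow>\<^sup>* v" if "awalk w r v" "d \<in> set r" "head G d = u \<or> tail G d = u" for w r d
    proof -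
      have "d \<in> arcs G" using that by auto
      then have "tail G d \<rightarrow>\<^sup>* head G d" using in_arcs_imp_in_arcs_ends by blast
      then show ?thesis using awalk_arc_reachable[OF that(1,2)] that(3) reachable_trans by blast
    qed
    have after: "v \<rightarrow>\<^sup>* u" if "awalk v r w" "d \<in> set r" "head G d = u \<or> tail G d = u" for w r d
    proof -
      have "d \<in> arcs G" using that by auto
      then have "tail G d \<rightarrow>\<^sup>* head G d" using in_arcs_imp_in_arcs_ends by blast
      then show ?thesis using awalk_arc_reachable[OF that(1,2)] that(3) reachable_trans by blast
    qed
    consider "\<not> u \<rightarrow>\<^sup>* v" | "\<not> v \<rightarrow>\<^sup>* u" using uv reachable_antisym by blast
    then show ?thesis
    proof cases
      case 1
      then have "label_change G F (p @ [e]) u = 0" "label_change G F (p' @ [e']) u = 0"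
        using before pq(4) pq'(4) by (blast intro!: label_change_eq_0)+
      then show ?thesis unfolding R(2) S(2)
        using g_vector_label_change[OF _ True] R(1) S(1) R' S'
        by (simp add: pq(1) pq'(1) R'_def S'_def label_change_append del: append_assoc)
    next
      case 2
      then have "label_change G F (f # q) u = 0" "label_change G F (f' # q') u = 0"
        using after pq(5) pq'(5) by (blast intro!: label_change_eq_0)+
      then show ?thesis unfolding R(2) S(2)
        using g_vector_label_change[OF _ True] R(1) S(1) R' S'
        by (simp add: pq(1) pq'(1) R'_def S'_def label_change_append del: append_assoc)
    qed
  qed
  then show "\<exists>x'\<in>g_vector G F ` {R. route G R}. \<exists>y'\<in>g_vector G F ` {R. route G R}.
      x' v = 0 \<and> y' v = 0 \<and>
      (\<forall>u. u \<noteq> v \<longrightarrow> (x' u = x u \<and> y' u = y u) \<or> (x' u = y u \<and> y' u = x u))"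
    using R' S' 0 by (intro bexI[of _ "g_vector G F R'"] bexI[of _ "g_vector G F S'"]) auto
qed

section \<open>Zeroing a coordinate by rerouting\<close>

lemma inner_headI: "e \<in> arcs G \<Longrightarrow> \<not> sink G (head G e) \<Longrightarrow> head G e \<in> inners"
  using not_source_head by (auto simp: Defs.inner_verts_def)

lemma inner_tailI: "e \<in> arcs G \<Longrightarrow> \<not> source G (tail G e) \<Longrightarrow> tail G e \<in> inners"
  using not_sink_tail by (auto simp: Defs.inner_verts_def)

lemma walk_to_sink_labeled:
  assumes v: "v \<in> inners" and c: "c \<in> {1, 2}"
  obtains q t where "sink G t" "awalk v q t" "\<And>e. e \<in> set q \<Longrightarrow> F e = c"
proof -
  \<comment> \<open>An arc of \<open>?E\<close> is required at every vertex that is not a sink, also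
    at sources, where label \<open>c\<close> need not occur; hence the implication. The walk starts
    at an inner vertex and later enters no source, so all its tails are inner.\<close>
  let ?E = "{e \<in> arcs G. tail G e \<in> inners \<longrightarrow> F e = c}"
  have "\<exists>e\<in>?E. e \<in> arcs G \<and> tail G e = w" if "w \<in> verts G" "\<not> sink G w" for w
    using that not_sinkE[OF that] out_arc_labeled[OF _ c, of w] by (cases "w \<in> inners") blast+
  then obtain q t where q: "sink G t" "awalk v q t" "set q \<subseteq> ?E"
    using awalk_to_sink[of ?E v] inner_vertsD[OF v] by blast
  have "tail G e \<in> inners" if e: "e \<in> set q" for e
  proof (cases "tail G e = v")
    case False
    then obtain d where "d \<in> set q" "head G d = tail G e"
      using awalk_through_tail[OF q(2) e] by auto
    then show ?thesis using q(3) e not_source_head[of d] by (intro inner_tailI) auto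
  qed (use v in simp)
  then show ?thesis using that q by blast
qed

lemma walk_from_source_labeled:
  assumes v: "v \<in> inners" and c: "c \<in> {1, 2}"
  obtains p s where "source G s" "awalk s p v" "\<And>e. e \<in> set p \<Longrightarrow> F e = c"
proof -
  let ?E = "{e \<in> arcs G. head G e \<in> inners \<longrightarrow> F e = c}"
  have "\<exists>e\<in>?E. e \<in> arcs G \<and> head G e = w" if "w \<in> verts G" "\<not> source G w" for w
    using that not_sourceE[OF that] in_arc_labeled[OF _ c, of w] by (cases "w \<in> inners") blast+
  then obtain p s where p: "source G s" "awalk s p v" "set p \<subseteq> ?E"
    using awalk_from_source[of ?E v] inner_vertsD[OF v] by blast
  have "head G e \<in> inners" if e: "e \<in> set p" for e
  proof (cases "head G e = v")
    case False
    then obtain d where "d \<in> set p" "tail G d = head G e"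
      using awalk_through_head[OF p(2) e] by auto
    then show ?thesis using p(3) e not_sink_tail[of d] by (intro inner_headI) auto
  qed (use v in simp)
  then show ?thesis using that p by blast
qed

text \<open>At a nonzero coordinate the labels of \<open>e\<close> and \<open>f\<close> differ, so
  by coherence one of these arcs has a non-inner end: \<open>f\<close> is the last arc of the route
  or \<open>e\<close> is the first. That arc is replaced by a walk carrying the label of the other
  one. This equalizes the labels at \<open>v\<close> and, the label being constant, leaves all other
  inner coordinates alone.\<close>

lemma g_vectors_zero_closed:
  assumes coh: coherent and R: "route G R" and v: "v \<in> inners"
  shows "(g_vector G F R)(v := 0) \<in> g_vector G F ` {R. route G R}"
proof (cases "g_vector G F R v = 0")
  case True
  then show ?thesis using R by (auto simp: fun_upd_idem)
next
  case False
  then obtain e f where ef: "e \<in> set R" "f \<in> set R" "head G e = v" "tail G f = v"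
    using g_vector_neq_0E by blast
  obtain s p q t where pq: "R = (p @ [e]) @ f # q" "source G s" "sink G t"
    "awalk s (p @ [e]) v" "awalk v (f # q) t"
    by (rule route_splitE[OF R ef])
  have arcs: "e \<in> arcs G" "f \<in> arcs G" using ef route_subset_arcs[OF R] by auto
  have lab: "F e \<in> {1, 2}" "F f \<in> {1, 2}" using arcs label by auto
  have g: "g_vector G F R v = real (F e) - real (F f)" using g_vector_eq[OF R ef v] .
  have ends: "\<not> (tail G e \<in> inners \<and> head G f \<in> inners)"
    using coh arcs ef v g False unfolding coherent_def by auto
  have "\<exists>R'. route G R' \<and> g_vector G F R' v = 0 \<and>
      (\<forall>u\<in>inners. u \<noteq> v \<longrightarrow> label_change G F R' u = label_change G F R u)"
  proof -
    consider "head G f \<notin> inners" | "tail G e \<notin> inners" using ends by blast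
    then show ?thesis
    proof cases
      case 1
      then have "sink G (head G f)" using inner_headI arcs by blast
      then have "q = []" using pq(5) not_sink_tail by (cases q) (auto simp: awalk_simps)
      obtain q' t' where q': "sink G t'" "awalk v q' t'" "\<And>d. d \<in> set q' \<Longrightarrow> F d = F e"
        using walk_to_sink_labeled[OF v lab(1)] by metis
      have R': "route G ((p @ [e]) @ q')"
        unfolding route_iff_awalk using pq q' awalk_appendI by blast
      have ne: "q' \<noteq> []" using q' v by (auto simp: awalk_simps Defs.inner_verts_def)
      then have "tail G (hd q') = v" using q'(2) by (cases q') (auto simp: awalk_simps)
      then have "g_vector G F ((p @ [e]) @ q') v = real (F e) - real (F (hd q'))"
        using v ef ne by (intro g_vector_eq[OF R']) auto
      then have "g_vector G F ((p @ [e]) @ q') v = 0" using q'(3) ne by simp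
      moreover have "label_change G F ((p @ [e]) @ q') u = label_change G F R u"
        if "u \<in> inners" "u \<noteq> v" for u
      proof -
        have "label_change G F q' u = 0"
          using label_change_const[OF q'(2,3), of u] that q'(1) by (auto simp: Defs.inner_verts_def)
        moreover have "label_change G F [f] u = 0"
          using that ef 1 by (intro label_change_eq_0) auto
        ultimately show ?thesis
          unfolding pq(1) \<open>q = []\<close> by (simp add: label_change_append del: append_assoc)
      qed
      ultimately show ?thesis using R' by blast
    next
      case 2
      then have "source G (tail G e)" using inner_tailI arcs by blast
      then have "p = []" using pq(4) not_source_head by (cases p rule: rev_cases) (auto simp: awalk_simps, metis)
      obtain p' s' where p': "source G s'" "awalk s' p' v" "\<And>d. d \<in> set p' \<Longrightarrow> F d = F f"
        using walk_from_source_labeled[OF v lab(2)] by metis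
      have R': "route G (p' @ f # q)"
        unfolding route_iff_awalk using pq p' awalk_appendI by blast
      have ne: "p' \<noteq> []" using p' v by (auto simp: awalk_simps Defs.inner_verts_def)
      then have "head G (last p') = v" using p'(2) by (cases p' rule: rev_cases) (auto simp: awalk_simps)
      then have "g_vector G F (p' @ f # q) v = real (F (last p')) - real (F f)"
        using v ef ne by (intro g_vector_eq[OF R']) auto
      then have "g_vector G F (p' @ f # q) v = 0" using p'(3) ne by simp
      moreover have "label_change G F (p' @ f # q) u = label_change G F R u"
        if "u \<in> inners" "u \<noteq> v" for u
      proof -
        have "label_change G F p' u = 0"
          using label_change_const[OF p'(2,3), of u] that p'(1) by (auto simp: Defs.inner_verts_def)
        moreover have "label_change G F [e] u = 0"
          using that ef 2 by (intro label_change_eq_0) auto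
        ultimately show ?thesis
          unfolding pq(1) \<open>p = []\<close> by (simp add: label_change_append del: append_assoc append_Cons)
      qed
      ultimately show ?thesis using R' by blast
    qed
  qed
  then obtain R' where R': "route G R'" "g_vector G F R' v = 0"
    "\<And>u. u \<in> inners \<Longrightarrow> u \<noteq> v \<Longrightarrow> label_change G F R' u = label_change G F R u" by blast
  have "g_vector G F R' u = ((g_vector G F R)(v := 0)) u" for u
  proof (cases "u \<in> inners")
    case True
    then show ?thesis using R'(2,3) g_vector_label_change[OF _ True] R R'(1) by auto
  next
    case False
    then show ?thesis using v by (auto simp: g_vector_def)
  qed
  then show ?thesis using R'(1) by (metis (no_types, lifting) ext imageI mem_Collect_eq)
qed

lemma coherent_imp_locally_anti_blocking:
  assumes coherent
  shows "locally_anti_blocking inners (g_polytope G F)"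
  unfolding g_polytope_def
proof (rule locally_anti_blocking_convex_hull[OF finite_inner_verts])
  show "g_vector G F ` {R. route G R} \<subseteq> coord_space inners"
    by (auto simp: coord_space_def g_vector_def)
  show "exchange_closed (g_vector G F ` {R. route G R})"
    by (rule exchange_closed_g_vectors)
  show "x v \<in> {-1, 0, 1}" if "x \<in> g_vector G F ` {R. route G R}" for x v
    using that g_vector_vals by auto
  show "x(v := 0) \<in> g_vector G F ` {R. route G R}"
    if "x \<in> g_vector G F ` {R. route G R}" "v \<in> inners" for x v
    using that g_vectors_zero_closed[OF assms] by auto
qed

section \<open>The separating functional for an incoherent framing\<close>

lemma locally_anti_blocking_imp_coherent:
  assumes lab: "locally_anti_blocking inners (g_polytope G F)"
  shows coherent
proof (rule ccontr)
  assume "\<not> coherent"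
  then obtain e f where ef: "e \<in> arcs G" "f \<in> arcs G" "head G e = tail G f"
    and inn: "tail G e \<in> inners" "head G e \<in> inners" "head G f \<in> inners"
    and neq: "F e \<noteq> F f" unfolding coherent_def by auto
  define u where "u = tail G e"
  define v where "v = head G e"
  define w where "w = head G f"
  have uvw: "u \<in> inners" "v \<in> inners" "w \<in> inners" "tail G f = v"
    using ef inn by (auto simp: u_def v_def w_def)
  have "u \<noteq> v" "v \<noteq> w"
    using ef arc_not_reachable_back[of e] arc_not_reachable_back[of f]
    by (auto simp: u_def v_def w_def)
  \<comment> \<open>The labels along \<open>d\<close>, \<open>e\<close>, \<open>f\<close>,
    \<open>h\<close> alternate, so the coordinates at \<open>u\<close>, \<open>v\<close> and
    \<open>w\<close> are nonzero with alternating signs.\<close>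
  obtain d where d: "d \<in> arcs G" "head G d = u" "F d = F f"
    using in_arc_labeled[OF uvw(1)] label ef by blast
  obtain h where h: "h \<in> arcs G" "tail G h = w" "F h = F e"
    using out_arc_labeled[OF uvw(3)] label ef by blast
  obtain s p where p: "source G s" "awalk s p (tail G d)"
    using vert_has_route d(1) tail_in_verts by metis
  obtain q t where q: "sink G t" "awalk (head G h) q t"
    using vert_has_route h(1) head_in_verts by metis
  define R where "R = p @ [d, e, f, h] @ q"
  have R: "route G R"
    unfolding route_iff_awalk R_def using p q d h ef uvw
    by (intro exI[of _ s] exI[of _ t]) (auto simp: awalk_Cons_iff u_def v_def w_def intro!: awalk_appendI)
  define x where "x = g_vector G F R"
  have xu: "x u = real (F f) - real (F e)" 
    unfolding x_def using d uvw by (subst g_vector_eq[OF R, of d e]) (auto simp: R_def u_def)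
  have xv: "x v = real (F e) - real (F f)"
    unfolding x_def using uvw by (subst g_vector_eq[OF R, of e f]) (auto simp: R_def v_def)
  have xw: "x w = real (F f) - real (F e)"
    unfolding x_def using h uvw by (subst g_vector_eq[OF R, of f h]) (auto simp: R_def w_def)
  have sq: "x u * x u = 1" "x w * x w = 1" and xvu: "x v = - x u" and xwu: "x w = x u"
    using neq label[OF ef(1)] label[OF ef(2)] xu xv xw by auto

  \<comment> \<open>If a route agrees with \<open>x\<close> at \<open>u\<close> and
    \<open>w\<close>, it agrees at \<open>v\<close> too and \<open>L\<close> is 1 + 1 - 1/2 = 3/2.
    Otherwise the first two terms sum to at most 1 and the last adds at most 1/2. The point
    \<open>x(v := 0)\<close> has \<open>L\<close> equal to 2.\<close>
  define L where "L = (\<lambda>z::'a \<Rightarrow> real. x u * z u + x w * z w - x v * z v / 2)"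
  have bound: "L (g_vector G F S) \<le> 3/2" if S: "route G S" for S
  proof -
    let ?z = "g_vector G F S"
    have ranges: "x y * ?z y \<le> 1" "x y * ?z y \<ge> -1" for y
      using g_vector_vals[of R y] g_vector_vals[of S y] unfolding x_def by auto
    show ?thesis
    proof (cases "x u * ?z u = 1 \<and> x w * ?z w = 1")
      case True
      then have zu: "?z u = x u" and zw: "?z w = x w"
        using g_vector_vals[of R u] g_vector_vals[of S u] g_vector_vals[of R w] g_vector_vals[of S w]
        unfolding x_def by auto
      have S_arcs: "set S \<subseteq> arcs G" using S by (rule route_subset_arcs)
      have "?z u \<noteq> 0" "?z w \<noteq> 0" using zu zw sq by auto
      obtain d' e' where 1: "d' \<in> set S" "e' \<in> set S" "head G d' = u" "tail G e' = u"
        using g_vector_neq_0E[OF \<open>?z u \<noteq> 0\<close>] by metis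
      obtain f' h' where 2: "f' \<in> set S" "h' \<in> set S" "head G f' = w" "tail G h' = w"
        using g_vector_neq_0E[OF \<open>?z w \<noteq> 0\<close>] by metis
      have dS: "d' \<in> arcs G" and eS: "e' \<in> arcs G" and fS: "f' \<in> arcs G" and hS: "h' \<in> arcs G"
        using 1 2 S_arcs by auto
      \<comment> \<open>A nonzero difference of labels from 1 and 2 determines both labels, and a
        label determines the arc at an inner vertex. So the route leaves \<open>u\<close> by
        \<open>e\<close>, and likewise enters \<open>w\<close> by \<open>f\<close>, which fixes its
        passage through \<open>v\<close>.\<close>
      have "real (F d') - real (F e') = real (F f) - real (F e)"
        using g_vector_eq[OF S 1 uvw(1)] zu xu by simp
      then have "F e' = F e"
        using label[OF dS] label[OF eS] label[OF ef(1)] label[OF ef(2)] neq by auto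
      then have "e' = e"
        using 1 S_arcs ef uvw by (intro out_arcs_eqI[of _ _ u]) (auto simp: u_def)
      have "real (F f') - real (F h') = real (F f) - real (F e)"
        using g_vector_eq[OF S 2 uvw(3)] zw xw by simp
      then have "F f' = F f"
        using label[OF fS] label[OF hS] label[OF ef(1)] label[OF ef(2)] neq by auto
      then have "f' = f"
        using 2 S_arcs ef uvw by (intro in_arcs_eqI[of _ _ w]) (auto simp: w_def)
      have "?z v = real (F e) - real (F f)"
        using 1 2 \<open>e' = e\<close> \<open>f' = f\<close> uvw by (intro g_vector_eq[OF S]) (auto simp: v_def)
      then have "?z v = x v" using xv by simp
      then have "x v * ?z v = 1" using xvu sq(1) by simp
      then show ?thesis unfolding L_def using True by linarith
    next
      case False
      then have "x u * ?z u \<le> 0 \<or> x w * ?z w \<le> 0"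
        using g_vector_vals[of R u] g_vector_vals[of S u] g_vector_vals[of R w] g_vector_vals[of S w]
        unfolding x_def by auto
      then show ?thesis using ranges[of u] ranges[of v] ranges[of w] by (auto simp: L_def)
    qed
  qed
  have "convex {z. L z \<le> 3/2}"
  proof (rule convexI, clarify)
    fix y z :: "'a \<Rightarrow> real" and a b :: real
    assume *: "L y \<le> 3/2" "L z \<le> 3/2" "0 \<le> a" "0 \<le> b" "a + b = 1"
    have "L (a *\<^sub>R y + b *\<^sub>R z) = a * L y + b * L z"
      by (simp add: L_def scaleR_fun_def algebra_simps)
    also have "\<dots> \<le> a * (3/2) + b * (3/2)" using * by (intro add_mono mult_left_mono)
    also have "\<dots> = 3/2" using *(5) by (simp flip: distrib_right)
    finally show "L (a *\<^sub>R y + b *\<^sub>R z) \<le> 3/2" .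
  qed
  then have P: "L z \<le> 3/2" if "z \<in> g_polytope G F" for z
    using that bound hull_minimal[of "g_vector G F ` {R. route G R}" "{z. L z \<le> 3/2}" convex]
    unfolding g_polytope_def by blast

  \<comment> \<open>These are the signs of \<open>x\<close>, with 1 where \<open>x\<close> vanishes
    because a sign vector must avoid 0.\<close>
  define \<sigma> :: "'a \<Rightarrow> real" where "\<sigma> = (\<lambda>i. if x i < 0 then -1 else 1)"
  let ?Q = "(\<lambda>x i. \<sigma> i * x i) ` g_polytope G F \<inter> nonneg_orthant inners"
  have anti: "anti_blocking inners ?Q"
    using lab unfolding locally_anti_blocking_def by (auto simp: \<sigma>_def)
  have xP: "x \<in> g_polytope G F"
    unfolding g_polytope_def x_def using R by (intro hull_inc) auto
  have off: "x i = 0" if "i \<notin> inners" for i using that by (simp add: x_def g_vector_def)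
  have down: "b \<in> ?Q" if "a \<in> ?Q" "b \<in> coord_space inners" "\<forall>i\<in>inners. 0 \<le> b i \<and> b i \<le> a i" for a b
    by (rule anti[unfolded anti_blocking_def, THEN conjunct2, rule_format, OF that(1,2)]) (use that(3) in simp)
  have "(\<lambda>i. \<sigma> i * x i) \<in> ?Q"
    using xP off by (auto simp: nonneg_orthant_def coord_space_def \<sigma>_def)
  moreover have "(\<lambda>i. \<sigma> i * (x(v := 0)) i) \<in> coord_space inners"
    using off by (auto simp: coord_space_def)
  ultimately have "(\<lambda>i. \<sigma> i * (x(v := 0)) i) \<in> ?Q"
    by (rule down) (auto simp: \<sigma>_def)
  then obtain y where y: "y \<in> g_polytope G F" "(\<lambda>i. \<sigma> i * (x(v := 0)) i) = (\<lambda>i. \<sigma> i * y i)" by blast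
  have "y i = (x(v := 0)) i" for i
    using fun_cong[OF y(2), of i] by (auto simp: \<sigma>_def split: if_splits)
  then have "L y = 2" using sq \<open>u \<noteq> v\<close> \<open>v \<noteq> w\<close> by (simp add: L_def)
  then show False using P[OF y(1)] by simp
qed

lemma locally_anti_blocking_framing_iff_coherent:
  "locally_anti_blocking_framing G F \<longleftrightarrow> coherent"
  using coherent_imp_locally_anti_blocking locally_anti_blocking_imp_coherent ample
  by (auto simp: locally_anti_blocking_framing_def)

end

section \<open>Linear orientations of the inner graph\<close>

lemma maximal_runs:
  fixes P :: "'a \<Rightarrow> bool"
  shows "\<exists>ps. concat ps = es \<and> (\<forall>p\<in>set ps. p \<noteq> [] \<and> (\<forall>e\<in>set p. P e = P (hd p)) \<and>
    (\<exists>a b. es = a @ p @ b \<and> (a \<noteq> [] \<longrightarrow> P (last a) \<noteq> P (hd p)) \<and> (b \<noteq> [] \<longrightarrow> P (hd b) \<noteq> P (hd p))))"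
proof -
  define run where "run = (\<lambda>es p. p \<noteq> [] \<and> (\<forall>e\<in>set p. P e = P (hd p)) \<and>
       (\<exists>a b. es = a @ p @ b \<and> (a \<noteq> [] \<longrightarrow> P (last a) \<noteq> P (hd p)) \<and> (b \<noteq> [] \<longrightarrow> P (hd b) \<noteq> P (hd p))))"
  \<comment> \<open>The induction keeps the part \<open>pre\<close> already split off: the change of
    \<open>P\<close> at its border makes the next run maximal on the left.\<close>
  have runs: "\<exists>ps. concat ps = rest \<and> (\<forall>p\<in>set ps. run (pre @ rest) p)"
    if "pre = [] \<or> rest = [] \<or> P (last pre) \<noteq> P (hd rest)" for pre rest
    using that
  proof (induction rest arbitrary: pre rule: length_induct)
    case (1 rest)
    show ?case
    proof (cases "rest = []")
      case True
      then show ?thesis by (intro exI[of _ "[]"]) auto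
    next
      case False
      let ?Q = "\<lambda>e. P e = P (hd rest)"
      define p where "p = takeWhile ?Q rest"
      define r where "r = dropWhile ?Q rest"
      have rest: "rest = p @ r" by (simp add: p_def r_def)
      have p: "p \<noteq> []" "hd p = hd rest" using False by (cases rest; simp add: p_def)+
      have all: "\<forall>e\<in>set p. P e = P (hd p)" unfolding p(2) by (auto simp: p_def dest: set_takeWhileD)
      have r: "r \<noteq> [] \<Longrightarrow> P (hd r) \<noteq> P (hd p)"
        unfolding p(2) r_def by (rule hd_dropWhile)
      have "P (last p) = P (hd p)" using all p by auto
      then have "pre @ p = [] \<or> r = [] \<or> P (last (pre @ p)) \<noteq> P (hd r)" using r p by auto
      moreover have "length r < length rest" using rest p by simp
      ultimately have "\<exists>ps. concat ps = r \<and> (\<forall>q\<in>set ps. run ((pre @ p) @ r) q)"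
        using "1.IH"[rule_format, of r "pre @ p"] by blast
      then obtain ps where ps: "concat ps = r" "\<forall>q\<in>set ps. run ((pre @ p) @ r) q" by blast
      have "pre @ rest = pre @ p @ r" "pre \<noteq> [] \<longrightarrow> P (last pre) \<noteq> P (hd p)"
        using rest "1.prems" False p(2) by auto
      then have "run (pre @ rest) p" using p(1) all r unfolding run_def by blast
      then have "\<forall>q\<in>set (p # ps). run (pre @ rest) q" using ps(2) rest by simp
      then show ?thesis using ps(1) rest by (intro exI[of _ "p # ps"]) auto
    qed
  qed
  show ?thesis using runs[of "[]" es] unfolding run_def by simp
qed

lemma nth_inverse:
  assumes "distinct xs" and f: "inj_on f {..<length xs}"
  shows "\<exists>g. inj_on g (set xs) \<and> (\<forall>i<length xs. g (xs ! i) = f i)"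
proof (intro exI conjI allI impI)
  let ?g = "\<lambda>x. f (THE j. j < length xs \<and> xs ! j = x)"
  show g: "?g (xs ! i) = f i" if "i < length xs" for i
  proof -
    have "(THE j. j < length xs \<and> xs ! j = xs ! i) = i"
      using that assms by (auto simp: nth_eq_iff_index_eq)
    then show ?thesis by simp
  qed
  show "inj_on ?g (set xs)"
  proof (rule inj_onI)
    fix x y assume "x \<in> set xs" "y \<in> set xs" and eq: "?g x = ?g y"
    then obtain i j where ij: "i < length xs" "x = xs ! i" "j < length xs" "y = xs ! j"
      by (auto simp: in_set_conv_nth)
    then have "f i = f j" using eq g by simp
    then show "x = y" using ij inj_onD[OF f, of i j] by simp
  qed
qed

text \<open>An orientation of the underlying multigraph, in general different from the one of the
  digraph, for which in- and outdegrees are at most one.\<close>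

definition linear_orientation ::
    "('v, 'e) pre_digraph \<Rightarrow> ('e \<Rightarrow> 'v) \<Rightarrow> ('e \<Rightarrow> 'v) \<Rightarrow> bool" where
  "linear_orientation H s t \<longleftrightarrow>
     inj_on s (arcs H) \<and> inj_on t (arcs H) \<and> (\<forall>e\<in>arcs H. joins H e (s e) (t e))"

text \<open>Edges are oriented in the direction of traversal; both ends are then determined by
  position, and vertices do not repeat.\<close>

lemma undirected_path_graph_imp_linear_orientation:
  assumes "undirected_path_graph H vs es"
  shows "\<exists>s t. linear_orientation H s t"
proof -
  note * = assms[unfolded undirected_path_graph_def]
  have f: "inj_on ((!) vs) {..<length es}" "inj_on (\<lambda>i. vs ! (i + 1)) {..<length es}"
    using * by (auto simp: inj_on_def nth_eq_iff_index_eq)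
  have "distinct es" using * by blast
  from nth_inverse[OF this f(1)] obtain s where
    s: "inj_on s (set es)" "\<forall>i<length es. s (es ! i) = vs ! i" by (elim exE conjE)
  from nth_inverse[OF \<open>distinct es\<close> f(2)] obtain t where
    t: "inj_on t (set es)" "\<forall>i<length es. t (es ! i) = vs ! (i + 1)" by (elim exE conjE)
  have "joins H e (s e) (t e)" if "e \<in> set es" for e
  proof -
    obtain i where "i < length es" "e = es ! i"
      using \<open>e \<in> set es\<close> by (auto simp: in_set_conv_nth)
    then show ?thesis using * s t by simp
  qed
  then show ?thesis
    using * s(1) t(1) unfolding linear_orientation_def by metis
qed

text \<open>Again the direction of traversal, now with a cyclic shift of positions. It is a map on
  edges rather than on pairs of ends, so the two parallel edges of a cycle of length 2 get opposite
  directions.\<close>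

lemma undirected_cycle_graph_imp_linear_orientation:
  assumes "undirected_cycle_graph H vs es"
  shows "\<exists>s t. linear_orientation H s t"
proof -
  note * = assms[unfolded undirected_cycle_graph_def]
  have "distinct es" using * by blast
  have f: "inj_on ((!) vs) {..<length es}"
    using * by (auto simp: inj_on_def nth_eq_iff_index_eq)
  have f': "inj_on (\<lambda>i. vs ! ((i + 1) mod length es)) {..<length es}"
  proof (rule inj_onI)
    fix i j assume ij: "i \<in> {..<length es}" "j \<in> {..<length es}"
      and eq: "vs ! ((i + 1) mod length es) = vs ! ((j + 1) mod length es)"
    then have "length es > 0" by auto
    then have "(i + 1) mod length es = (j + 1) mod length es"
      using eq * nth_eq_iff_index_eq[of vs "(i + 1) mod length es" "(j + 1) mod length es"] by simp
    then show "i = j" using ij by (auto simp: mod_Suc split: if_splits)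
  qed
  from nth_inverse[OF \<open>distinct es\<close> f] obtain s where
    s: "inj_on s (set es)" "\<forall>i<length es. s (es ! i) = vs ! i" by (elim exE conjE)
  from nth_inverse[OF \<open>distinct es\<close> f'] obtain t where
    t: "inj_on t (set es)" "\<forall>i<length es. t (es ! i) = vs ! ((i + 1) mod length es)" by (elim exE conjE)
  have "joins H e (s e) (t e)" if "e \<in> set es" for e
  proof -
    obtain i where "i < length es" "e = es ! i"
      using \<open>e \<in> set es\<close> by (auto simp: in_set_conv_nth)
    then show ?thesis using * s t by simp
  qed
  then show ?thesis
    using * s(1) t(1) unfolding linear_orientation_def by metis
qed

section \<open>Coherent framings versus linear orientations\<close>

lemma inner_graph_simps [simp]:
  "verts (inner_graph G) = inner_verts G" "tail (inner_graph G) = tail G" "head (inner_graph G) = head G"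
  "arcs (inner_graph G) = {e \<in> arcs G. tail G e \<in> inner_verts G \<and> head G e \<in> inner_verts G}"
  by (auto simp: inner_graph_def induce_subgraph_def)

text \<open>Arcs of different labels with the same new start (or end) would be consecutive in the
  digraph, against coherence. Arcs of equal label with the same new start share their tail or share
  their head, so ampleness identifies them; the same holds for ends.\<close>

lemma (in ample_framed_dag) coherent_imp_linear_orientation:
  assumes coherent
  shows "\<exists>s t. linear_orientation (inner_graph G) s t"
proof -
  let ?s = "\<lambda>e. if F e = 1 then tail G e else head G e"
  let ?t = "\<lambda>e. if F e = 1 then head G e else tail G e"
  have coh: "F e = F f" if "e \<in> arcs (inner_graph G)" "f \<in> arcs (inner_graph G)" "head G e = tail G f" for e f
    using assms that unfolding coherent_def by auto
  have "e = f" if "e \<in> arcs (inner_graph G)" "f \<in> arcs (inner_graph G)" "?s e = ?s f" for e f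
  proof -
    have "F e = F f" using that coh[of e f] coh[of f e] label[of e] label[of f] by (auto split: if_splits)
    then show ?thesis
      using that label[of e] label[of f] in_arcs_eqI[of e f "head G f"] out_arcs_eqI[of e f "tail G f"] by (auto split: if_splits)
  qed
  moreover have "e = f" if "e \<in> arcs (inner_graph G)" "f \<in> arcs (inner_graph G)" "?t e = ?t f" for e f
  proof -
    have "F e = F f" using that coh[of e f] coh[of f e] label[of e] label[of f] by (auto split: if_splits)
    then show ?thesis
      using that label[of e] label[of f] in_arcs_eqI[of e f "head G f"] out_arcs_eqI[of e f "tail G f"] by (auto split: if_splits)
  qed
  ultimately show ?thesis
    unfolding linear_orientation_def
    by (intro exI[of _ ?s] exI[of _ ?t]) (auto simp: joins_def inj_on_def)
qed

lemma extend_inj_labeling: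
  fixes f :: "'a \<Rightarrow> nat"
  assumes "card A = 2" "B \<subseteq> A" "inj_on f B" "f ` B \<subseteq> {1, 2}"
  shows "\<exists>g. inj_on g A \<and> g ` A \<subseteq> {1, 2} \<and> (\<forall>x\<in>B. g x = f x)"
proof -
  obtain a b where ab: "A = {a, b}" "a \<noteq> b" using assms(1) by (auto simp: card_2_iff)
  \<comment> \<open>The map \<open>3 - c\<close> exchanges the labels 1 and 2.\<close>
  define ca where "ca = (if a \<in> B then f a else if b \<in> B then 3 - f b else 1)"
  define cb where "cb = 3 - ca"
  have fB: "f x = 1 \<or> f x = 2" if "x \<in> B" for x using assms(4) that by auto
  have ca: "ca = 1 \<or> ca = 2" using fB[of a] fB[of b] by (auto simp: ca_def)
  have cb: "b \<in> B \<Longrightarrow> cb = f b"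
  proof -
    assume b: "b \<in> B"
    have "a \<in> B \<Longrightarrow> f a \<noteq> f b" using b ab(2) assms(3) by (meson inj_onD)
    then show "cb = f b" using fB[of a] fB[OF b] b unfolding cb_def ca_def by (cases "a \<in> B") auto
  qed
  show ?thesis
  proof (intro exI conjI)
    let ?g = "\<lambda>x. if x = a then ca else cb"
    have "ca \<noteq> cb" "cb = 1 \<or> cb = 2" using ca by (auto simp: cb_def)
    then show "inj_on ?g A" "?g ` A \<subseteq> {1, 2}" using ab ca by (auto simp: inj_on_def)
    show "\<forall>x\<in>B. ?g x = f x" using cb ab assms(2) by (auto simp: ca_def)
  qed
qed

text \<open>Inner arcs receive label 1 or 2 according to whether the two orientations agree. The
  remaining arcs are labeled at each inner vertex separately; the choices cannot clash, as such an
  arc has at most one inner end.\<close>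

lemma (in dag) linear_orientation_imp_framing:
  assumes full: "full G" and lin: "linear_orientation (inner_graph G) s t"
  shows "\<exists>F. ample_framing G F \<and> ample_framed_dag.coherent G F"
proof -
  let ?A = "arcs (inner_graph G)"
  define F0 where "F0 = (\<lambda>e. if s e = tail G e then 1 else 2::nat)"
  have st: "s e = (if F0 e = 1 then tail G e else head G e)" "t e = (if F0 e = 1 then head G e else tail G e)"
    if "e \<in> ?A" for e
  proof -
    have "joins (inner_graph G) e (s e) (t e)" using lin that unfolding linear_orientation_def by blast
    then show "s e = (if F0 e = 1 then tail G e else head G e)" "t e = (if F0 e = 1 then head G e else tail G e)"
      by (auto simp: joins_def F0_def)
  qed
  have inj: "inj_on s ?A" "inj_on t ?A" using lin by (auto simp: linear_orientation_def)
  have F0: "F0 ` X \<subseteq> {1, 2}" for X by (auto simp: F0_def)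
  have inj_in: "inj_on F0 (?A \<inter> in_arcs G v)" for v
  proof (rule inj_onI)
    fix e f assume *: "e \<in> ?A \<inter> in_arcs G v" "f \<in> ?A \<inter> in_arcs G v" "F0 e = F0 f"
    then have "s e = s f \<or> t e = t f" using st[of e] st[of f] by auto
    then show "e = f" using inj * by (meson IntD1 inj_onD)
  qed
  have inj_out: "inj_on F0 (?A \<inter> out_arcs G v)" for v
  proof (rule inj_onI)
    fix e f assume *: "e \<in> ?A \<inter> out_arcs G v" "f \<in> ?A \<inter> out_arcs G v" "F0 e = F0 f"
    then have "s e = s f \<or> t e = t f" using st[of e] st[of f] by auto
    then show "e = f" using inj * by (meson IntD1 inj_onD)
  qed
  have "\<exists>g. inj_on g (in_arcs G v) \<and> g ` in_arcs G v \<subseteq> {1, 2} \<and> (\<forall>e\<in>?A \<inter> in_arcs G v. g e = F0 e)"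
    if "v \<in> inners" for v
    using full that by (intro extend_inj_labeling inj_in F0) (auto simp: full_def in_degree_def)
  then obtain fin where fin: "\<And>v. v \<in> inners \<Longrightarrow> inj_on (fin v) (in_arcs G v)"
    "\<And>v. v \<in> inners \<Longrightarrow> fin v ` in_arcs G v \<subseteq> {1, 2}"
    "\<And>v e. v \<in> inners \<Longrightarrow> e \<in> ?A \<inter> in_arcs G v \<Longrightarrow> fin v e = F0 e" by metis
  have "\<exists>g. inj_on g (out_arcs G v) \<and> g ` out_arcs G v \<subseteq> {1, 2} \<and> (\<forall>e\<in>?A \<inter> out_arcs G v. g e = F0 e)"
    if "v \<in> inners" for v
    using full that by (intro extend_inj_labeling inj_out F0) (auto simp: full_def out_degree_def)
  then obtain fout where fout: "\<And>v. v \<in> inners \<Longrightarrow> inj_on (fout v) (out_arcs G v)"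
    "\<And>v. v \<in> inners \<Longrightarrow> fout v ` out_arcs G v \<subseteq> {1, 2}"
    "\<And>v e. v \<in> inners \<Longrightarrow> e \<in> ?A \<inter> out_arcs G v \<Longrightarrow> fout v e = F0 e" by metis
  \<comment> \<open>On an arc with two inner ends both local labelings equal \<open>F0\<close>. The
    value 1 is a default for arcs from a source straight to a sink.\<close>
  define F where "F = (\<lambda>e. if head G e \<in> inners then fin (head G e) e
    else if tail G e \<in> inners then fout (tail G e) e else 1)"
  have FA: "F e = F0 e" if "e \<in> ?A" for e using that fin(3) by (auto simp: F_def)
  have Fin: "F e = fin v e" if "v \<in> inners" "e \<in> in_arcs G v" for e v using that by (auto simp: F_def)
  have Fout: "F e = fout v e" if "v \<in> inners" "e \<in> out_arcs G v" for e v
  proof (cases "head G e \<in> inners")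
    case True
    then have "e \<in> ?A" using that by auto
    then show ?thesis using FA[of e] fout(3)[of v e] that by auto
  next
    case False
    then show ?thesis using that by (auto simp: F_def)
  qed
  have ample: "ample_framing G F"
    unfolding ample_framing_def
  proof (intro conjI ballI)
    fix e assume e: "e \<in> arcs G"
    show "F e \<in> {1, 2}"
      using fin(2)[of "head G e"] fout(2)[of "tail G e"] e unfolding F_def by (auto simp: image_subset_iff)
  next
    fix v assume v: "v \<in> inners"
    show "inj_on F (in_arcs G v)" using fin(1)[OF v] by (simp only: inj_on_cong[OF Fin[OF v]])
    show "inj_on F (out_arcs G v)" using fout(1)[OF v] by (simp only: inj_on_cong[OF Fout[OF v]])
  qed
  interpret ample_framed_dag G F using full ample by unfold_locales
  have coherent unfolding coherent_def
  proof (intro ballI impI)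
    fix e f assume ef: "e \<in> arcs G" "f \<in> arcs G"
      "tail G e \<in> inners \<and> head G e \<in> inners \<and> tail G f \<in> inners \<and> head G f \<in> inners \<and> head G e = tail G f"
    then have A: "e \<in> ?A" "f \<in> ?A" by auto
    have "e \<noteq> f" using ef arc_not_reachable_back[of e] by auto
    then have "s e \<noteq> s f" "t e \<noteq> t f" using inj A by (auto dest: inj_onD)
    moreover have "F0 e = 1 \<or> F0 e = 2" "F0 f = 1 \<or> F0 f = 2" using F0[of "{e, f}"] by auto
    \<comment> \<open>With different labels, the common vertex would be the new start of both arcs
      or the new end of both.\<close>
    ultimately have "F0 e = F0 f" using st[OF A(1)] st[OF A(2)] ef(3) by auto
    then show "F e = F f" using FA A by metis
  qed
  then show ?thesis using ample by blast
qed

lemma (in dag) dag_inner_graph: "dag (inner_graph G)"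
proof unfold_locales
  have "arcs_ends (inner_graph G) \<subseteq> arcs_ends G" by (auto simp: arcs_ends_conv)
  then show "acyclic (arcs_ends (inner_graph G))" using acyclic acyclic_subset by blast
  show "finite (verts (inner_graph G))" "finite (arcs (inner_graph G))"
    by (simp_all add: finite_inner_verts)
  show "tail (inner_graph G) e \<in> verts (inner_graph G)" "head (inner_graph G) e \<in> verts (inner_graph G)"
    if "e \<in> arcs (inner_graph G)" for e
    using that unfolding inner_graph_simps by blast+
qed

section \<open>Spanning chains in the connected inner graph\<close>

locale linearly_oriented_dag = dag +
  fixes s t :: "'b \<Rightarrow> 'a"
  assumes linear: "linear_orientation (inner_graph G) s t"
    and conn: "Digraph_Component.connected (inner_graph G)"
begin

definition inner_arcs :: "'b set" where
  "inner_arcs = {e \<in> arcs G. tail G e \<in> inners \<and> head G e \<in> inners}"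

definition forward :: "'b \<Rightarrow> bool" where
  "forward e \<longleftrightarrow> s e = tail G e"

lemma arcs_inner_graph: "arcs (inner_graph G) = inner_arcs"
  by (simp add: inner_arcs_def)

lemma inj_s: "inj_on s inner_arcs" and inj_t: "inj_on t inner_arcs"
  using linear unfolding linear_orientation_def arcs_inner_graph by auto

lemma joins_s_t: "e \<in> inner_arcs \<Longrightarrow> joins G e (s e) (t e)"
  using linear unfolding linear_orientation_def arcs_inner_graph by (simp add: joins_def)

lemma s_eqD: "e \<in> inner_arcs \<Longrightarrow> f \<in> inner_arcs \<Longrightarrow> s e = s f \<Longrightarrow> e = f"
  using inj_s by (rule inj_onD)

lemma t_eqD: "e \<in> inner_arcs \<Longrightarrow> f \<in> inner_arcs \<Longrightarrow> t e = t f \<Longrightarrow> e = f"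
  using inj_t by (rule inj_onD)

lemma tail_neq_head: "e \<in> inner_arcs \<Longrightarrow> tail G e \<noteq> head G e"
  using arc_not_reachable_back[of e] by (auto simp: inner_arcs_def)

lemma forwardD:
  assumes "e \<in> inner_arcs"
  shows "forward e \<Longrightarrow> tail G e = s e \<and> head G e = t e"
    and "\<not> forward e \<Longrightarrow> tail G e = t e \<and> head G e = s e"
  using joins_s_t[OF assms] by (auto simp: forward_def joins_def)

lemma s_t_in_inners:
  assumes "e \<in> inner_arcs" shows "s e \<in> inners" "t e \<in> inners"
  using joins_s_t[OF assms] assms by (auto simp: joins_def inner_arcs_def)

lemma finite_inner_arcs: "finite inner_arcs"
  by (simp add: inner_arcs_def)

text \<open>This is how connectedness is used: an undirected walk in the inner graph that starts in
  \<open>W\<close> never leaves it.\<close>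

lemma closed_eq_inners:
  assumes W: "W \<inter> inners \<noteq> {}"
    and closed: "\<And>e. e \<in> inner_arcs \<Longrightarrow> s e \<in> W \<longleftrightarrow> t e \<in> W"
  shows "inners \<subseteq> W"
proof
  fix v assume v: "v \<in> inners"
  obtain u where u: "u \<in> W" "u \<in> inners" using W by blast
  interpret H: dag "inner_graph G" by (rule dag_inner_graph)
  have "(u, v) \<in> rtrancl_on inners ((arcs_ends (inner_graph G))\<^sup>s)"
    using conn u v unfolding connected_conv by simp
  then have "(u, v) \<in> ((arcs_ends (inner_graph G))\<^sup>s)\<^sup>*" by (rule rtrancl_on_rtranclI)
  then show "v \<in> W"
  proof (induction rule: rtrancl_induct)
    case base
    then show ?case using u by simp
  next
    case (step y z)
    then obtain e where "e \<in> inner_arcs" "joins G e y z"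
      unfolding symcl_def arcs_ends_conv arcs_inner_graph by (auto simp: joins_def)
    then show ?case using step.IH joins_s_t[of e] closed[of e] by (auto simp: joins_def)
  qed
qed

text \<open>The start \<open>v\<close> is an explicit argument so that the empty chain, which covers
  a single inner vertex, still has a place.\<close>

definition chain :: "'a \<Rightarrow> 'b list \<Rightarrow> bool" where
  "chain v es \<longleftrightarrow> set es \<subseteq> inner_arcs \<and> distinct es \<and> successively (\<lambda>e f. t e = s f) es \<and>
     (es \<noteq> [] \<longrightarrow> s (hd es) = v)"

lemma maximal_chain:
  "\<exists>es. chain v es \<and> (\<forall>f\<in>inner_arcs. s f = last (v # map t es) \<longrightarrow> f \<in> set es)"
proof -
  have bound: "length es < Suc (card inner_arcs)" if "chain v es" for es
    using that card_mono[OF finite_inner_arcs, of "set es"] by (auto simp: chain_def distinct_card)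
  have "chain v []" by (simp add: chain_def)
  then have "\<exists>es. chain v es \<and> (\<forall>es'. chain v es' \<longrightarrow> length es' \<le> length es)"
    by (rule ex_has_greatest_nat) (use bound in blast)
  then obtain es where es: "chain v es" "\<And>es'. chain v es' \<Longrightarrow> length es' \<le> length es" by blast
  have "f \<in> set es" if f: "f \<in> inner_arcs" "s f = last (v # map t es)" for f
  proof (rule ccontr)
    assume "f \<notin> set es"
    moreover have "es \<noteq> [] \<Longrightarrow> t (last es) = s f" "es = [] \<Longrightarrow> s f = v"
      using f(2) by (simp_all add: last_map)
    ultimately have "chain v (es @ [f])"
      using es(1) f(1) unfolding chain_def successively_append_iff by (cases "es = []") simp_all
    then have "length (es @ [f]) \<le> length es" by (rule es(2))
    then show False by simp
  qed
  then show ?thesis using es(1) by blast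
qed

lemma chain_nth:
  assumes "chain v es" "i < length es"
  shows "s (es ! i) = (v # map t es) ! i"
proof (cases i)
  case 0
  then show ?thesis using assms unfolding chain_def by (cases es) simp_all
next
  case (Suc j)
  then have "t (es ! j) = s (es ! Suc j)"
    using assms unfolding chain_def successively_conv_nth by blast
  then show ?thesis using Suc assms(2) by simp
qed

text \<open>A chain can only fail to exhaust the arcs at its start, so it spans as soon as no arc
  outside it ends there.\<close>

lemma spanning_chain:
  assumes v: "v \<in> inners" and ch: "chain v es"
    and maxi: "\<And>f. f \<in> inner_arcs \<Longrightarrow> s f = last (v # map t es) \<Longrightarrow> f \<in> set es"
    and start: "\<And>f. f \<in> inner_arcs \<Longrightarrow> t f = v \<Longrightarrow> f \<in> set es"
  shows "set es = inner_arcs" "set (v # map t es) = inners"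
proof -
  let ?W = "set (v # map t es)"
  have sub: "set es \<subseteq> inner_arcs" using ch by (simp add: chain_def)
  have s_in: "s e \<in> ?W" if "e \<in> set es" for e
  proof -
    obtain i where "i < length es" "e = es ! i" using \<open>e \<in> set es\<close> by (auto simp: in_set_conv_nth)
    then show ?thesis using chain_nth[OF ch, of i] nth_mem[of i "v # map t es"] by simp
  qed
  \<comment> \<open>By injectivity of \<open>s\<close>, an arc starting at a chain vertex is the
    chain arc starting there, unless the vertex is the final one, where maximality applies. Dually,
    injectivity of \<open>t\<close> settles arcs ending at a chain vertex other than
    \<open>v\<close>.\<close>
  have from_s: "f \<in> set es" if f: "f \<in> inner_arcs" "s f \<in> ?W" for f
  proof -
    obtain i where i: "i < length (v # map t es)" "s f = (v # map t es) ! i"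
      using f(2) unfolding in_set_conv_nth by metis
    show ?thesis
    proof (cases "i < length es")
      case True
      then have "s (es ! i) = s f" using chain_nth[OF ch] i by simp
      then show ?thesis using s_eqD[of "es ! i" f] f(1) nth_mem[OF True] sub by auto
    next
      case False
      then have "i = length es" using i by simp
      then have "s f = last (v # map t es)" using i(2) by (simp add: last_conv_nth)
      then show ?thesis using maxi f by blast
    qed
  qed
  have from_t: "f \<in> set es" if f: "f \<in> inner_arcs" "t f \<in> ?W" for f
    using f start t_eqD[of f] sub by auto
  have "inners \<subseteq> ?W"
  proof (rule closed_eq_inners)
    show "?W \<inter> inners \<noteq> {}" using v by auto
    fix e assume e: "e \<in> inner_arcs"
    show "s e \<in> ?W \<longleftrightarrow> t e \<in> ?W"
    proof
      assume "s e \<in> ?W"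
      then have "e \<in> set es" by (rule from_s[OF e])
      then show "t e \<in> ?W" by simp
    next
      assume "t e \<in> ?W"
      then have "e \<in> set es" by (rule from_t[OF e])
      then show "s e \<in> ?W" by (rule s_in)
    qed
  qed
  moreover have "?W \<subseteq> inners" using v sub s_t_in_inners(2) by auto
  ultimately show W: "?W = inners" by (rule equalityI[rotated])
  show "set es = inner_arcs"
  proof
    show "inner_arcs \<subseteq> set es"
    proof
      fix f assume f: "f \<in> inner_arcs"
      then have "s f \<in> ?W" unfolding W by (rule s_t_in_inners(1))
      then show "f \<in> set es" by (rule from_s[OF f])
    qed
  qed (rule sub)
qed

text \<open>The predecessor of \<open>l\<close> in the list ends at \<open>s l\<close>, hence is
  \<open>g\<close> by injectivity of \<open>t\<close>. The condition on \<open>v\<close> excludes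
  the joint of a closed chain, where the last and the first arc meet but are not list
  neighbours.\<close>

lemma consecutive_in_chain:
  assumes ch: "chain v es" and span: "set es = inner_arcs"
    and g: "g \<in> inner_arcs" and l: "l \<in> inner_arcs" and gl: "t g = s l" and ne: "s l \<noteq> v"
  obtains x y where "es = x @ g # l # y"
proof -
  obtain j where j: "j < length es" "es ! j = l" using l span by (metis in_set_conv_nth)
  have "j \<noteq> 0" using chain_nth[OF ch j(1)] j(2) ne by (cases j) auto
  then obtain i where i: "j = Suc i" by (cases j) auto
  then have "t (es ! i) = s l" using chain_nth[OF ch j(1)] j by simp
  moreover have "es ! i \<in> inner_arcs" using span i j nth_mem[of i es] by simp
  ultimately have "es ! i = g" using t_eqD g gl by simp
  then have "es = take i es @ g # l # drop (Suc (Suc i)) es"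
    using i j by (metis Cons_nth_drop_Suc Suc_lessD append_take_drop_id)
  then show ?thesis using that by blast
qed

section \<open>Maximal runs as inner routes\<close>

lemma successively_imp_cas:
  "p \<noteq> [] \<Longrightarrow> successively (\<lambda>e f. head G e = tail G f) p \<Longrightarrow> cas (tail G (hd p)) p (head G (last p))"
proof (induction p rule: induct_list012)
  case (3 e f p)
  then show ?case by auto
qed auto

lemma inner_path_iff:
  "inner_path G p \<longleftrightarrow> (\<exists>u v. u \<in> inners \<and> set p \<subseteq> inner_arcs \<and> cas u p v)"
proof -
  interpret H: dag "inner_graph G" by (rule dag_inner_graph)
  have "compatible (inner_graph G) G" by (simp add: compatible_def)
  then have "pre_digraph.cas (inner_graph G) = cas" by (rule compatible_cas)
  moreover have "H.apath u p v \<longleftrightarrow> H.awalk u p v" for u v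
    using H.awalk_imp_apath H.awalkI_apath by blast
  ultimately show ?thesis
    unfolding inner_path_def H.awalk_def arcs_inner_graph inner_graph_simps(1) by metis
qed

text \<open>A prolonging arc would continue the run in the same direction, hence be its neighbour in
  the list, against the change of direction there. The only gap is the start \<open>v\<close> of the
  chain; by \<open>start\<close> it has no incoming arc in one of the two orientations, so no
  directed path passes from the end of the list to its beginning.\<close>

lemma maximal_run_inner_route:
  assumes ch: "chain v es" and span: "set es = inner_arcs"
    and start: "(\<forall>e\<in>inner_arcs. t e \<noteq> v) \<or> (\<forall>e\<in>inner_arcs. head G e \<noteq> v)"
    and es: "es = a @ p @ b" and p: "p \<noteq> []" "\<forall>e\<in>set p. forward e = forward (hd p)"
    and a: "a \<noteq> [] \<longrightarrow> forward (last a) \<noteq> forward (hd p)"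
    and b: "b \<noteq> [] \<longrightarrow> forward (hd b) \<noteq> forward (hd p)"
  shows "inner_route G (if forward (hd p) then p else rev p)"
proof -
  let ?r = "if forward (hd p) then p else rev p"
  have pA: "set p \<subseteq> inner_arcs" using es span by auto
  have dist: "distinct es" and succ: "successively (\<lambda>e f. t e = s f) p"
    using ch es by (auto simp: chain_def successively_append_iff)
  have rA: "set ?r \<subseteq> inner_arcs" and r: "?r \<noteq> []" using pA p(1) by auto
  have hp: "hd p \<in> inner_arcs" and lp: "last p \<in> inner_arcs" using p(1) pA by auto
  have lp_dir: "forward (last p) = forward (hd p)" using p last_in_set by blast
  have succ': "successively (\<lambda>e f. head G e = tail G f) ?r"
  proof (cases "forward (hd p)")
    case True
    have "successively (\<lambda>e f. head G e = tail G f) p"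
      using succ by (rule successively_mono) (use True p(2) pA forwardD(1) in \<open>metis subsetD\<close>)
    then show ?thesis using True by simp
  next
    case False
    have "successively (\<lambda>e f. head G f = tail G e) p"
      using succ by (rule successively_mono) (use False p(2) pA forwardD(2) in \<open>metis subsetD\<close>)
    then show ?thesis using False by (simp add: successively_rev)
  qed
  have "tail G (hd ?r) \<in> inners" using rA hd_in_set[OF r] by (auto simp: inner_arcs_def)
  then have path: "inner_path G ?r"
    unfolding inner_path_iff using rA successively_imp_cas[OF r succ'] by blast

  have no_prev: "forward g \<noteq> forward (hd p)" if g: "g \<in> inner_arcs" "t g = s (hd p)" for g
  proof
    assume dir: "forward g = forward (hd p)"
    \<comment> \<open>Otherwise \<open>g\<close> ends at \<open>v\<close> in the new orientation;
      and as \<open>g\<close> and \<open>hd p\<close> point the same way, one of them has its head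
      at \<open>v\<close>. Both alternatives of \<open>start\<close> fail.\<close>
    have "s (hd p) \<noteq> v"
      using start g forwardD[OF g(1)] forwardD[OF hp] dir hp by metis
    then obtain x y where xy: "es = x @ g # hd p # y"
      using consecutive_in_chain[OF ch span g(1) hp g(2)] by metis
    \<comment> \<open>Arcs do not repeat in \<open>es\<close>, so its two splittings around
      \<open>hd p\<close> coincide and \<open>g\<close> is the last arc of \<open>a\<close>.\<close>
    have "hd p \<notin> set (x @ [g])" "hd p \<notin> set y" using dist unfolding xy by auto
    then have "(x @ [g]) @ hd p # y = a @ hd p # (tl p @ b) \<longleftrightarrow> x @ [g] = a \<and> y = tl p @ b"
      by (rule append_Cons_eq_iff)
    moreover have "(x @ [g]) @ hd p # y = a @ hd p # (tl p @ b)" using es xy p(1) by simp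
    ultimately have "x @ [g] = a" by blast
    then show False using a dir by auto
  qed
  have no_next: "forward g \<noteq> forward (hd p)" if g: "g \<in> inner_arcs" "s g = t (last p)" for g
  proof
    assume dir: "forward g = forward (hd p)"
    have "s g \<noteq> v"
      using start g forwardD[OF g(1)] forwardD[OF lp] dir lp_dir lp by metis
    then obtain x y where xy: "es = x @ last p # g # y"
      using consecutive_in_chain[OF ch span lp g(1)] g(2) by metis
    have "last p \<notin> set x" "last p \<notin> set (g # y)" using dist unfolding xy by auto
    then have "x @ last p # g # y = (a @ butlast p) @ last p # b \<longleftrightarrow> x = a @ butlast p \<and> g # y = b"
      by (rule append_Cons_eq_iff)
    moreover have "x @ last p # g # y = (a @ butlast p) @ last p # b"
      using es p(1) append_butlast_last_id[of p] unfolding xy[symmetric] by simp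
    ultimately have "g # y = b" by blast
    then show False using b dir by auto
  qed
  \<comment> \<open>In the new orientation, \<open>g\<close> meets the end vertex either in the same
    role as the final arc of the directed run, and then equals it by injectivity, which is
    impossible; or in the opposite role, and then points the same way as the run, against
    \<open>no_next\<close> or \<open>no_prev\<close>.\<close>
  have no_out: "tail G g \<noteq> head G (last ?r)" if g: "g \<in> inner_arcs" for g
  proof
    assume eq: "tail G g = head G (last ?r)"
    show False
    proof (cases "forward (hd p)")
      case True
      then have "tail G g = t (last p)" using eq forwardD(1)[OF lp] lp_dir by simp
      then show False
        using forwardD[OF g] no_next[OF g] True t_eqD[OF g lp] tail_neq_head[OF g] eq by metis
    next
      case False
      then have "tail G g = s (hd p)" using eq forwardD(2)[OF hp] p(1) by (simp add: last_rev)
      then show False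
        using forwardD[OF g] no_prev[OF g] False s_eqD[OF g hp] forwardD(2)[OF hp] by metis
    qed
  qed
  have no_in: "head G g \<noteq> tail G (hd ?r)" if g: "g \<in> inner_arcs" for g
  proof
    assume eq: "head G g = tail G (hd ?r)"
    show False
    proof (cases "forward (hd p)")
      case True
      then have "head G g = s (hd p)" using eq forwardD(1)[OF hp] by simp
      then show False
        using forwardD[OF g] no_prev[OF g] True s_eqD[OF g hp] by metis
    next
      case False
      then have "head G g = t (last p)" using eq forwardD(2)[OF lp] lp_dir p(1) by (simp add: hd_rev)
      then show False
        using forwardD[OF g] no_next[OF g] False t_eqD[OF g lp] lp_dir by metis
    qed
  qed
  have "q = ?r" if q: "inner_path G q" "sublist ?r q" for q
  proof -
    obtain x y where xy: "q = x @ ?r @ y" using q(2) by (auto simp: sublist_def)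
    obtain u w where uw: "set q \<subseteq> inner_arcs" "cas u q w" using q(1) by (auto simp: inner_path_iff)
    have "y = []"
    proof (rule ccontr)
      assume y: "y \<noteq> []"
      then have "tail G (hd y) = head G (last ?r)"
        using uw(2) r unfolding xy by (cases y) (auto simp: awalk_verts_conv)
      moreover have "hd y \<in> inner_arcs" using uw(1) hd_in_set[OF y] unfolding xy by auto
      ultimately show False using no_out by blast
    qed
    moreover have "x = []"
    proof (rule ccontr)
      assume x: "x \<noteq> []"
      then have "head G (last x) = tail G (hd ?r)"
        using uw(2) r unfolding xy by (cases ?r) (auto simp: awalk_verts_conv)
      moreover have "last x \<in> inner_arcs" using uw(1) last_in_set[OF x] unfolding xy by auto
      ultimately show False using no_in by blast
    qed
    ultimately show ?thesis using xy by simp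
  qed
  then show ?thesis unfolding inner_route_def using path by blast
qed

lemma spanning_chain_inner_route_concat:
  assumes ch: "chain v es" and span: "set es = inner_arcs"
    and start: "(\<forall>e\<in>inner_arcs. t e \<noteq> v) \<or> (\<forall>e\<in>inner_arcs. head G e \<noteq> v)"
  shows "\<exists>ks. (\<forall>k\<in>set ks. k > 0) \<and> inner_route_concat G ks es"
proof -
  obtain ps where ps: "concat ps = es"
    "\<forall>p\<in>set ps. p \<noteq> [] \<and> (\<forall>e\<in>set p. forward e = forward (hd p)) \<and>
       (\<exists>a b. es = a @ p @ b \<and> (a \<noteq> [] \<longrightarrow> forward (last a) \<noteq> forward (hd p)) \<and>
         (b \<noteq> [] \<longrightarrow> forward (hd b) \<noteq> forward (hd p)))"
    using maximal_runs[of es forward] by (elim exE conjE)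
  let ?f = "\<lambda>p. if forward (hd p) then p else rev p"
  have route: "inner_route G (?f p)" if "p \<in> set ps" for p
    using bspec[OF ps(2) that]
  proof (elim conjE exE)
    fix a b assume "es = a @ p @ b" "p \<noteq> []" "\<forall>e\<in>set p. forward e = forward (hd p)"
      "a \<noteq> [] \<longrightarrow> forward (last a) \<noteq> forward (hd p)" "b \<noteq> [] \<longrightarrow> forward (hd b) \<noteq> forward (hd p)"
    then show ?thesis by (rule maximal_run_inner_route[OF ch span start])
  qed
  have "inner_route_concat G (map length ps) es"
    unfolding inner_route_concat_def
  proof (intro exI conjI)
    show "\<forall>r\<in>set (map ?f ps). inner_route G r" using route unfolding set_map by blast
    show "map length (map ?f ps) = map length ps" by simp
    show "list_all2 (\<lambda>r p. p = r \<or> p = rev r) (map ?f ps) ps" by (simp add: list_all2_conv_all_nth)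
    show "es = concat ps" using ps(1) by simp
  qed
  moreover have "\<forall>k\<in>set (map length ps). k > 0" using ps(2) by auto
  ultimately show ?thesis by blast
qed

section \<open>Assembling the path or the cycle\<close>

lemma inner_source: "\<exists>v\<in>inners. \<forall>e\<in>inner_arcs. head G e \<noteq> v"
proof -
  have "inners \<noteq> {}" using conn unfolding connected_conv by simp
  moreover have "wf (arcs_ends G)"
    using finite_arcs_ends acyclic by (rule finite_acyclic_wf)
  ultimately obtain v where v: "v \<in> inners" "\<And>y. (y, v) \<in> arcs_ends G \<Longrightarrow> y \<notin> inners"
    by (metis all_not_in_conv wf_eq_minimal)
  have "head G e \<noteq> v" if "e \<in> inner_arcs" for e
    using v(2)[of "tail G e"] that by (auto simp: arcs_ends_conv inner_arcs_def)
  then show ?thesis using v(1) by blast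
qed

text \<open>If every inner vertex has an incoming arc in the orientation, then a spanning chain closes
  up; starting it at a source of the inner graph makes sure that no inner route is cut in two.\<close>

lemma path_or_cycle:
  "\<exists>ks vs es. (\<forall>k\<in>set ks. k > 0) \<and> inner_route_concat G ks es \<and>
     (undirected_path_graph (inner_graph G) vs es \<or> undirected_cycle_graph (inner_graph G) vs es)"
proof (cases "inners \<subseteq> t ` inner_arcs")
  case False
  \<comment> \<open>A vertex without incoming arc in the new orientation is the forced start of a
    path; a single inner vertex falls under this case with an empty chain.\<close>
  then obtain v where v: "v \<in> inners" "\<And>e. e \<in> inner_arcs \<Longrightarrow> t e \<noteq> v" by blast
  obtain es where es: "chain v es"
    "\<And>f. f \<in> inner_arcs \<Longrightarrow> s f = last (v # map t es) \<Longrightarrow> f \<in> set es" using maximal_chain[of v] by blast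
  have "f \<in> set es" if "f \<in> inner_arcs" "t f = v" for f using that v(2) by blast
  note span = spanning_chain[OF v(1) es this]
  note A = span(1) and V = span(2)
  have "distinct es" using es(1) by (simp add: chain_def)
  have dV: "distinct (v # map t es)"
    using \<open>distinct es\<close> A inj_t v(2) by (auto simp: distinct_map)
  have joins: "joins (inner_graph G) (es ! i) ((v # map t es) ! i) ((v # map t es) ! (i + 1))"
    if "i < length es" for i
  proof -
    have "es ! i \<in> inner_arcs" using \<open>i < length es\<close> A nth_mem by blast
    then show ?thesis
      using joins_s_t[of "es ! i"] chain_nth[OF es(1) \<open>i < length es\<close>] \<open>i < length es\<close> by (simp add: joins_def)
  qed
  have "undirected_path_graph (inner_graph G) (v # map t es) es"
    unfolding undirected_path_graph_def
  proof (intro conjI allI impI)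
    show "set (v # map t es) = verts (inner_graph G)" unfolding inner_graph_simps(1) by (rule V)
    show "set es = arcs (inner_graph G)" unfolding arcs_inner_graph by (rule A)
    show "length (v # map t es) = length es + 1" by simp
  qed (fact dV \<open>distinct es\<close> joins)+
  moreover have "(\<forall>e\<in>inner_arcs. t e \<noteq> v) \<or> (\<forall>e\<in>inner_arcs. head G e \<noteq> v)" using v(2) by blast
  ultimately show ?thesis using spanning_chain_inner_route_concat[OF es(1) A] by blast
next
  case True
  have t_bij: "t ` inner_arcs = inners" using True s_t_in_inners by auto
  \<comment> \<open>Counting: there are as many inner arcs as inner vertices, so the injective
    \<open>s\<close> is onto as well and no chain has a dead end.\<close>
  have "card (s ` inner_arcs) = card inners"
    using card_image[OF inj_s] card_image[OF inj_t] t_bij by simp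
  then have s_bij: "s ` inner_arcs = inners"
    using s_t_in_inners finite_inner_verts by (intro card_subset_eq) auto
  obtain v where v: "v \<in> inners" and v_source: "\<And>e. e \<in> inner_arcs \<Longrightarrow> head G e \<noteq> v"
    using inner_source by blast
  obtain es where es: "chain v es"
    "\<And>f. f \<in> inner_arcs \<Longrightarrow> s f = last (v # map t es) \<Longrightarrow> f \<in> set es" using maximal_chain[of v] by blast
  have sub: "set es \<subseteq> inner_arcs" and dist: "distinct es" using es(1) by (auto simp: chain_def)
  have "set (v # map t es) \<subseteq> inners" using v sub s_t_in_inners(2) by auto
  then have "last (v # map t es) \<in> inners" using last_in_set[of "v # map t es"] by blast
  then obtain g where g: "g \<in> inner_arcs" "s g = last (v # map t es)" using s_bij by (metis imageE)
  then have "g \<in> set es" using es(2) by blast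
  then obtain j where j: "j < length es" "g = es ! j" by (auto simp: in_set_conv_nth)
  have ne: "es \<noteq> []" using j by auto
  \<comment> \<open>If \<open>g\<close> had a predecessor in the chain, that arc and
    \<open>last es\<close> would end at the same vertex, hence coincide, although the predecessor
    stands earlier. So the chain returns to its start.\<close>
  have "j = 0"
  proof (rule ccontr)
    assume "j \<noteq> 0"
    then obtain i where i: "j = Suc i" by (cases j) auto
    have "t (es ! i) = t (last es)"
      using chain_nth[OF es(1) j(1)] g(2) j i ne by (simp add: last_map)
    moreover have "es ! i \<in> inner_arcs" "last es \<in> inner_arcs" using sub j i ne nth_mem[of i es] by auto
    ultimately have "es ! i = last es" by (intro t_eqD)
    then show False using dist i j ne by (simp add: last_conv_nth nth_eq_iff_index_eq)
  qed
  then have wrap: "t (last es) = v"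
    using g(2) j chain_nth[OF es(1), of 0] ne by (simp add: last_map)
  have closing: "f \<in> set es" if "f \<in> inner_arcs" "t f = v" for f
  proof -
    have "last es \<in> inner_arcs" using sub ne by auto
    then have "f = last es" using that wrap by (intro t_eqD) auto
    then show ?thesis using ne by simp
  qed
  have A: "set es = inner_arcs" by (rule spanning_chain(1)[OF v es closing])
  have ds: "distinct (map s es)" unfolding distinct_map A using dist inj_s by blast
  have joins: "joins (inner_graph G) (es ! i) (map s es ! i) (map s es ! ((i + 1) mod length es))"
    if i: "i < length es" for i
  proof -
    have "t (es ! i) = s (es ! ((i + 1) mod length es))"
    proof (cases "i + 1 < length es")
      case True
      then show ?thesis using chain_nth[OF es(1) True] by simp
    next
      case False
      then have "i + 1 = length es" using i by simp
      then have "es ! i = last es" using ne by (metis add_diff_cancel_right' last_conv_nth)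
      then show ?thesis
        using \<open>i + 1 = length es\<close> wrap chain_nth[OF es(1), of 0] ne by simp
    qed
    moreover have "(i + 1) mod length es < length es" using ne by simp
    moreover have "es ! i \<in> inner_arcs" using i A nth_mem by blast
    ultimately show ?thesis using joins_s_t[of "es ! i"] i by (simp add: joins_def)
  qed
  have "undirected_cycle_graph (inner_graph G) (map s es) es"
    unfolding undirected_cycle_graph_def
  proof (intro conjI allI impI)
    show "set (map s es) = verts (inner_graph G)" unfolding inner_graph_simps(1) set_map A by (rule s_bij)
    show "set es = arcs (inner_graph G)" unfolding arcs_inner_graph by (rule A)
    show "length (map s es) = length es" by simp
  qed (fact ds dist ne joins)+
  moreover have "(\<forall>e\<in>inner_arcs. t e \<noteq> v) \<or> (\<forall>e\<in>inner_arcs. head G e \<noteq> v)" using v_source by blast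
  ultimately show ?thesis using spanning_chain_inner_route_concat[OF es(1) A] by blast
qed

end

theorem theorem3p5:
  fixes G :: "('v, 'e) pre_digraph"
  assumes "dag G"
    and "full G"
    and "\<not> (\<exists>e\<in>arcs G. idle G e)"
    and "Digraph_Component.connected (inner_graph G)"
  shows "(\<exists>F. locally_anti_blocking_framing G F) \<longleftrightarrow>
         (\<exists>ks. (\<forall>k\<in>set ks. k > 0) \<and> (is_Path ks G \<or> is_Cycle ks G))"
proof
  interpret dag G by (rule assms(1))
  assume "\<exists>F. locally_anti_blocking_framing G F"
  then obtain F where F: "locally_anti_blocking_framing G F" by blast
  then interpret ample_framed_dag G F
    using assms(2) by unfold_locales (auto simp: locally_anti_blocking_framing_def)
  obtain s t where "linear_orientation (inner_graph G) s t"
    using F coherent_imp_linear_orientation locally_anti_blocking_framing_iff_coherent by blast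
  then interpret linearly_oriented_dag G s t
    using assms(4) by unfold_locales
  show "\<exists>ks. (\<forall>k\<in>set ks. k > 0) \<and> (is_Path ks G \<or> is_Cycle ks G)"
    using path_or_cycle assms(1,2) unfolding is_Path_def is_Cycle_def by blast
next
  interpret dag G by (rule assms(1))
  assume "\<exists>ks. (\<forall>k\<in>set ks. k > 0) \<and> (is_Path ks G \<or> is_Cycle ks G)"
  then obtain ks where "is_Path ks G \<or> is_Cycle ks G" by blast
  then have "\<exists>s t. linear_orientation (inner_graph G) s t"
  proof
    assume "is_Path ks G"
    then obtain vs es where "undirected_path_graph (inner_graph G) vs es" by (auto simp: is_Path_def)
    then show ?thesis by (rule undirected_path_graph_imp_linear_orientation)
  next
    assume "is_Cycle ks G"
    then obtain vs es where "undirected_cycle_graph (inner_graph G) vs es" by (auto simp: is_Cycle_def)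
    then show ?thesis by (rule undirected_cycle_graph_imp_linear_orientation)
  qed
  then obtain F where F: "ample_framing G F" "ample_framed_dag.coherent G F"
    using linear_orientation_imp_framing assms(2) by blast
  interpret ample_framed_dag G F using assms(2) F(1) by unfold_locales
  show "\<exists>F. locally_anti_blocking_framing G F"
    using F(2) locally_anti_blocking_framing_iff_coherent by blast
qed

end
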